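(* Let $EDML^n_p=(J^1(T,M),L)$ be the autonomous metrical multi-time Lagrange space of electrodynamics with $L=h^{\alpha\beta}(t)g_{ij}(x)x^i_\alpha x^j_\beta+U^{(\alpha)}_{(i)}(t,x)x^i_\alpha+F(t,x)$, and let the stress-energy d-tensor $\mathcal T$ be related to the gravitational $h$-potential $G$ by the Einstein equations $Ric(C)-\frac{Sc(C)}{2}G=\mathcal K\mathcal T$ of the Cartan canonical connection. Then the conservation laws $\mathcal T^B_{A\vert B}=0$ for all $A\in\left\{\alpha,\,i,\,\begin{smallmatrix}(\alpha)\\(i)\end{smallmatrix}\right\}$ reduce to $$\left\{\begin{array}{l} \displaystyle\left[H^\mu_\beta-\frac{H+r}{2}\delta^\mu_\beta\right]_{/\mu}=0,\\[3mm] \displaystyle\left[r^m_j-\frac{H+r}{2}\delta^m_j\right]_{\vert m}=0, \end{array}\right.$$ where $H^\mu_\beta=h^{\mu\alpha}H_{\alpha\beta}$, $r^m_j=g^{mi}r_{ij}$, $H_{\alpha\beta}$, $r_{ij}$ are the Ricci tensors of $h_{\alpha\beta}$, $g_{ij}$, and $H=h^{\alpha\beta}H_{\alpha\beta}$, $r=g^{ij}r_{ij}$ their scalar curvatures.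
   Context: Setting. $T$ is a smooth real $p$-dimensional manifold with coordinates $t=(t^\alpha)$, $M$ a smooth real $n$-dimensional manifold with coordinates $x=(x^i)$; $J^1(T,M)$ is the 1-jet bundle with induced coordinates $(t^\alpha,x^i,x^i_\alpha)$. Repeated indices are summed. $h_{\alpha\beta}(t)$ and $g_{ij}(x)$ are semi-Riemannian metrics on $T$ and $M$ with inverses $h^{\alpha\beta}$, $g^{ij}$; $U^{(\alpha)}_{(i)}(t,x)$ are the components of a distinguished tensor (d-tensor) on $J^1(T,M)$, i.e. $U^{(\alpha)}_{(i)}=\frac{\partial t^\alpha}{\partial\tilde t^\beta}\frac{\partial\tilde x^j}{\partial x^i}\tilde U^{(\beta)}_{(j)}$ under changes of coordinates; $F(t,x)$ is a smooth function on $T\times M$. Put $U^{(\alpha)}_{(i)j}=\frac{\partial U^{(\alpha)}_{(i)}}{\partial x^j}-\frac{\partial U^{(\alpha)}_{(j)}}{\partial x^i}$. $H^\gamma_{\alpha\beta}$ and $\gamma^i_{jk}$ are the Christoffel symbols of $h$ and $g$. Canonical nonlinear connection. $\Gamma=(M^{(i)}_{(\alpha)\beta},N^{(i)}_{(\alpha)j})$ with $M^{(i)}_{(\alpha)\beta}=-H^\gamma_{\alpha\beta}x^i_\gamma$ and $N^{(i)}_{(\alpha)j}=\gamma^i_{jk}x^k_\alpha+\frac{h_{\alpha\gamma}g^{il}}{4}U^{(\gamma)}_{(l)j}$. Adapted frame $(X_A)=\left(\frac{\delta}{\delta t^\alpha},\frac{\delta}{\delta x^i},\frac{\partial}{\partial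 x^i_\alpha}\right)$, where $\frac{\delta}{\delta t^\alpha}=\frac{\partial}{\partial t^\alpha}-M^{(j)}_{(\beta)\alpha}\frac{\partial}{\partial x^j_\beta}$, $\frac{\delta}{\delta x^i}=\frac{\partial}{\partial x^i}-N^{(j)}_{(\beta)i}\frac{\partial}{\partial x^j_\beta}$; dual coframe $(dt^\alpha,dx^i,\delta x^i_\alpha)$ with $\delta x^i_\alpha=dx^i_\alpha+M^{(i)}_{(\alpha)\beta}dt^\beta+N^{(i)}_{(\alpha)j}dx^j$. The index values $A=\alpha$, $i$, $\begin{smallmatrix}(\alpha)\\(i)\end{smallmatrix}$ refer to the frame vectors $\frac{\delta}{\delta t^\alpha}$, $\frac{\delta}{\delta x^i}$, $\frac{\partial}{\partial x^i_\alpha}$ respectively. Cartan canonical connection of this space: the linear connection $\nabla$ on $J^1(T,M)$ whose only nonzero covariant derivatives of frame fields are $\nabla_{\delta/\delta t^\gamma}\frac{\delta}{\delta t^\alpha}=H^\beta_{\alpha\gamma}\frac{\delta}{\delta t^\beta}$, $\nabla_{\delta/\delta t^\gamma}\frac{\partial}{\partial x^i_\alpha}=-H^\alpha_{\beta\gamma}\frac{\partial}{\partial x^i_\beta}$, $\nabla_{\delta/\delta x^j}\frac{\delta}{\delta x^i}=\gamma^k_{ij}\frac{\delta}{\delta x^k}$, $\nabla_{\delta/\delta x^j}\frac{\partial}{\partial x^i_\alpha}=\gamma^k_{ij}\frac{\partial}{\partial x^k_\alpha}$ (i.e. $C\Gamma=(H^\gamma_{\alpha\beta},G^k_{j\gamma}=0,L^i_{jk}=\gamma^i_{jk},C^{i(\gamma)}_{j(k)}=0)$).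 The symbols "$_{/\mu}$" and "$_{\vert m}$" denote the induced covariant derivatives along $\frac{\delta}{\delta t^\mu}$ and $\frac{\delta}{\delta x^m}$: $S^\mu_{\beta/\nu}=\frac{\delta S^\mu_\beta}{\delta t^\nu}+S^\gamma_\beta H^\mu_{\gamma\nu}-S^\mu_\gamma H^\gamma_{\beta\nu}$ and $S^m_{j\vert k}=\frac{\delta S^m_j}{\delta x^k}+S^l_j\gamma^m_{lk}-S^m_l\gamma^l_{jk}$. Gravitational $h$-potential: $G=h_{\alpha\beta}dt^\alpha\otimes dt^\beta+g_{ij}dx^i\otimes dx^j+h^{\alpha\beta}g_{ij}\,\delta x^i_\alpha\otimes\delta x^j_\beta$, with $(G^{AB})$ the inverse matrix of its components $(G_{AB})$ in the adapted frame. Curvature: $\mathbf R(X,Y)Z=\nabla_X\nabla_YZ-\nabla_Y\nabla_XZ-\nabla_{[X,Y]}Z$, $\mathbf R(X_C,X_B)X_A=R^D_{ABC}X_D$; Ricci d-tensor $Ric(C)$ with components $R_{AB}=Ric(X_A,X_B)=R^D_{ABD}$; scalar curvature $Sc(C)=G^{AB}R_{AB}$. The Ricci tensors of $h$ and $g$ follow the same convention, e.g. $r_{ij}=r^k_{ijk}$ with $r^l_{ijk}=\frac{\partial\gamma^l_{ij}}{\partial x^k}-\frac{\partial\gamma^l_{ik}}{\partial x^j}+\gamma^s_{ij}\gamma^l_{sk}-\gamma^s_{ik}\gamma^l_{sj}$. $\mathcal K$ is the (nonzero) Einstein constant; $\mathcal T$ is a $(0,2)$ tensor with components $\mathcal T_{AB}=\mathcal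 T(X_A,X_B)$; $\mathcal T^B_A=G^{BD}\mathcal T_{DA}$, and $\mathcal T^B_{A\vert B}$ denotes the divergence $(\nabla_{X_B}\mathcal T)^B_A$ summed over all adapted indices $B$ (temporal, spatial and vertical). "Reduce to" means: under the Einstein equations, the system of conservation laws is equivalent to the displayed two-line system. *)

theory Defs
  imports "HOL-Analysis.Analysis"
begin

section \<open>Smooth manifolds given by atlases\<close>

primrec Ck_on ::
  "nat \<Rightarrow> 'a::real_normed_vector set \<Rightarrow> ('a \<Rightarrow> 'b::real_normed_vector) \<Rightarrow> bool" where
  "Ck_on 0 S f \<longleftrightarrow> continuous_on S f"
| "Ck_on (Suc k) S f \<longleftrightarrow> (\<forall>x\<in>S. f differentiable (at x)) \<and>
     (\<forall>v. Ck_on k S (\<lambda>x. frechet_derivative f (at x) v))"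

text \<open>Only used for open \<open>S\<close>.\<close>

definition smooth_on ::
  "'a::real_normed_vector set \<Rightarrow> ('a \<Rightarrow> 'b::real_normed_vector) \<Rightarrow> bool" where
  "smooth_on S f \<longleftrightarrow> (\<forall>k. Ck_on k S f)"

text \<open>A chart is a pair of its domain and its coordinate map; the values of the map outside
  the domain are irrelevant.\<close>

type_synonym ('a, 'e) chart = "'a set \<times> ('a \<Rightarrow> 'e)"

definition chart_image :: "('a, 'e) chart \<Rightarrow> 'e set" where
  "chart_image c = snd c ` fst c"

definition chart_overlap :: "('a, 'e) chart \<Rightarrow> ('a, 'e) chart \<Rightarrow> 'e set" where
  "chart_overlap c c' = snd c ` (fst c \<inter> fst c')"

definition transition :: "('a, 'e) chart \<Rightarrow> ('a, 'e) chart \<Rightarrow> 'e \<Rightarrow> 'e" where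
  "transition c c' u = snd c' (inv_into (fst c) (snd c) u)"

definition smooth_atlas :: "'a topology \<Rightarrow> ('a, 'e::euclidean_space) chart set \<Rightarrow> bool" where
  "smooth_atlas X \<A> \<longleftrightarrow>
     (\<Union>c\<in>\<A>. fst c) = topspace X \<and>
     (\<forall>c\<in>\<A>. openin X (fst c) \<and> open (chart_image c) \<and>
        homeomorphic_map (subtopology X (fst c)) (top_of_set (chart_image c)) (snd c)) \<and>
     (\<forall>c\<in>\<A>. \<forall>c'\<in>\<A>. smooth_on (chart_overlap c c') (transition c c'))"

definition smooth_manifold :: "'a topology \<Rightarrow> ('a, 'e::euclidean_space) chart set \<Rightarrow> bool" where
  "smooth_manifold X \<A> \<longleftrightarrow> Hausdorff_space X \<and> second_countable X \<and> smooth_atlas X \<A>"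

text \<open>A smooth \<open>(0,2)\<close> tensor field is given by its coordinate expressions: in the chart \<open>c\<close>, at
  the point with coordinates \<open>u\<close>, it is the bilinear form \<open>S c u\<close> on coordinate vectors.\<close>

type_synonym ('a, 'e) tensor_field2 = "('a, 'e) chart \<Rightarrow> 'e \<Rightarrow> 'e \<Rightarrow> 'e \<Rightarrow> real"

definition tensor02 ::
  "('a, 'e::euclidean_space) chart set \<Rightarrow> ('a, 'e) tensor_field2 \<Rightarrow> bool" where
  "tensor02 \<A> S \<longleftrightarrow>
     (\<forall>c\<in>\<A>. (\<forall>u\<in>chart_image c. bilinear (S c u)) \<and>
             (\<forall>v w. smooth_on (chart_image c) (\<lambda>u. S c u v w))) \<and>
     (\<forall>c\<in>\<A>. \<forall>c'\<in>\<A>. \<forall>u\<in>chart_overlap c c'. \<forall>v w.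
        S c u v w = S c' (transition c c' u)
          (frechet_derivative (transition c c') (at u) v)
          (frechet_derivative (transition c c') (at u) w))"

definition metric_index :: "('e::euclidean_space \<Rightarrow> 'e \<Rightarrow> real) \<Rightarrow> nat" where
  "metric_index B = Max {dim S | S. subspace S \<and> (\<forall>v\<in>S. v \<noteq> 0 \<longrightarrow> B v v < 0)}"

definition semi_riemannian ::
  "('a, 'e::euclidean_space) chart set \<Rightarrow> ('a, 'e) tensor_field2 \<Rightarrow> bool" where
  "semi_riemannian \<A> g \<longleftrightarrow> tensor02 \<A> g \<and>
     (\<forall>c\<in>\<A>. \<forall>u\<in>chart_image c.
        (\<forall>v w. g c u v w = g c u w v) \<and> (\<forall>v. (\<forall>w. g c u v w = 0) \<longrightarrow> v = 0)) \<and>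
     (\<exists>\<nu>. \<forall>c\<in>\<A>. \<forall>u\<in>chart_image c. metric_index (g c u) = \<nu>)"

definition comps :: "(real^'n \<Rightarrow> real^'n \<Rightarrow> real) \<Rightarrow> real^'n^'n" where
  "comps B = (\<chi> i j. B (axis i 1) (axis j 1))"


section \<open>The 1-jet bundle\<close>

text \<open>A 1-jet at \<open>t\<close> with target \<open>x\<close> is a linear map from the tangent space at \<open>t\<close> to the tangent
  space at \<open>x\<close>, represented by its matrix \<open>y c d\<close> in every pair of charts \<open>c\<close> around \<open>t\<close> and \<open>d\<close>
  around \<open>x\<close> (and by \<open>0\<close> for all other pairs, so that equal jets are equal triples).
  The entry \<open>y c d $ i $ \<alpha>\<close> is the coordinate \<open>x\<^sup>i\<^sub>\<alpha>\<close>; the matrix products spell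
  out the law \<open>x'\<^sup>i\<^sub>\<alpha> = (\<partial>x'\<^sup>i / \<partial>x\<^sup>j) (\<partial>t\<^sup>\<beta> / \<partial>t'\<^sup>\<alpha>) x\<^sup>j\<^sub>\<beta>\<close>.\<close>

type_synonym ('a, 'b, 'p, 'n) jet =
  "'a \<times> 'b \<times> (('a, real^'p) chart \<Rightarrow> ('b, real^'n) chart \<Rightarrow> real^'p^'n)"

type_synonym ('p, 'n) jcoord = "(real^'p) \<times> (real^'n) \<times> (real^'p^'n)"

definition J1 ::
  "'a topology \<Rightarrow> ('a, real^'p) chart set \<Rightarrow> 'b topology \<Rightarrow> ('b, real^'n) chart set
   \<Rightarrow> ('a, 'b, 'p, 'n) jet set" where
  "J1 T \<A> M \<B> = {(t, x, y). t \<in> topspace T \<and> x \<in> topspace M \<and>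
     (\<forall>c\<in>\<A>. \<forall>c'\<in>\<A>. \<forall>d\<in>\<B>. \<forall>d'\<in>\<B>.
        t \<in> fst c \<inter> fst c' \<longrightarrow> x \<in> fst d \<inter> fst d' \<longrightarrow>
        y c' d' = jacobian (transition d d') (at (snd d x)) ** y c d
                    ** jacobian (transition c' c) (at (snd c' t))) \<and>
     (\<forall>c d. \<not> (c \<in> \<A> \<and> d \<in> \<B> \<and> t \<in> fst c \<and> x \<in> fst d) \<longrightarrow> y c d = 0)}"

definition jet_chart ::
  "'a topology \<Rightarrow> ('a, real^'p) chart set \<Rightarrow> 'b topology \<Rightarrow> ('b, real^'n) chart set
   \<Rightarrow> ('a, real^'p) chart \<Rightarrow> ('b, real^'n) chart
   \<Rightarrow> (('a, 'b, 'p, 'n) jet, ('p, 'n) jcoord) chart" where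
  "jet_chart T \<A> M \<B> c d =
     ({(t, x, y). (t, x, y) \<in> J1 T \<A> M \<B> \<and> t \<in> fst c \<and> x \<in> fst d},
      (\<lambda>(t, x, y). (snd c t, snd d x, y c d)))"

definition jet_atlas ::
  "'a topology \<Rightarrow> ('a, real^'p) chart set \<Rightarrow> 'b topology \<Rightarrow> ('b, real^'n) chart set
   \<Rightarrow> (('a, 'b, 'p, 'n) jet, ('p, 'n) jcoord) chart set" where
  "jet_atlas T \<A> M \<B> = {jet_chart T \<A> M \<B> c d | c d. c \<in> \<A> \<and> d \<in> \<B>}"


text \<open>The coordinates \<open>(t\<^sup>\<alpha>, x\<^sup>i, x\<^sup>i\<^sub>\<alpha>)\<close> of an induced chart range over a full product, and
  determine the jet.\<close>

lemma chart_overlap_open: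
  assumes "smooth_atlas X \<A>" "c \<in> \<A>" "c' \<in> \<A>"
  shows "open (chart_overlap c c')"
proof -
  have o: "openin X (fst c)" "openin X (fst c')" and oi: "open (chart_image c)"
    and hm: "homeomorphic_map (subtopology X (fst c)) (top_of_set (chart_image c)) (snd c)"
    using assms by (auto simp: smooth_atlas_def)
  have "openin (subtopology X (fst c)) (fst c \<inter> fst c')"
    using o by (metis inf_commute openin_subtopology_Int)
  then have "openin (top_of_set (chart_image c)) (snd c ` (fst c \<inter> fst c'))"
    using hm homeomorphic_imp_open_map open_map_def by blast
  then show ?thesis
    using oi openin_open_eq unfolding chart_overlap_def by blast
qed

lemma chart_inj:
  assumes "smooth_atlas X \<A>" "c \<in> \<A>"
  shows "inj_on (snd c) (fst c)"
proof -
  have o: "openin X (fst c)"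
    and hm: "homeomorphic_map (subtopology X (fst c)) (top_of_set (chart_image c)) (snd c)"
    using assms by (auto simp: smooth_atlas_def)
  have "topspace (subtopology X (fst c)) = fst c"
    using o openin_subset by (metis topspace_subtopology_subset)
  then show ?thesis
    using hm by (metis homeomorphic_eq_everything_map)
qed

lemma transition_chart:
  assumes "smooth_atlas X \<A>" "c \<in> \<A>" "p \<in> fst c"
  shows "transition c c' (snd c p) = snd c' p"
  unfolding transition_def using chart_inj[OF assms(1,2)] assms(3) by simp

lemma transition_has_derivative:
  assumes "smooth_atlas X \<A>" "c \<in> \<A>" "c' \<in> \<A>" "p \<in> fst c \<inter> fst c'"
  shows "(transition c c' has_derivative frechet_derivative (transition c c') (at (snd c p)))
           (at (snd c p))"
proof -
  have "Ck_on (Suc 0) (chart_overlap c c') (transition c c')"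
    using assms unfolding smooth_atlas_def smooth_on_def by blast
  moreover have "snd c p \<in> chart_overlap c c'"
    using assms(4) by (auto simp: chart_overlap_def)
  ultimately show ?thesis
    using frechet_derivative_works by auto
qed

lemma jacobian_transition_comp:
  fixes \<A> :: "('a, real^'n) chart set"
  assumes "smooth_atlas X \<A>" "c \<in> \<A>" "c' \<in> \<A>" "c'' \<in> \<A>" "p \<in> fst c" "p \<in> fst c'" "p \<in> fst c''"
  shows "jacobian (transition c c'') (at (snd c p))
       = jacobian (transition c' c'') (at (snd c' p)) ** jacobian (transition c c') (at (snd c p))"
proof -
  let ?D = "\<lambda>c c'. frechet_derivative (transition c c') (at (snd c p))"
  let ?D2 = "frechet_derivative (transition c' c'') (at (snd c' p))"
  have D: "(transition c c'' has_derivative ?D c c'') (at (snd c p))"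
    "(transition c c' has_derivative ?D c c') (at (snd c p))"
    "(transition c' c'' has_derivative ?D2) (at (snd c' p))"
    by (auto intro!: transition_has_derivative[OF assms(1)] assms)
  have eq: "transition c c' (snd c p) = snd c' p"
    using transition_chart[OF assms(1,2,5)] .
  have "(transition c' c'' \<circ> transition c c' has_derivative ?D2 \<circ> ?D c c') (at (snd c p))"
    using diff_chain_at[OF D(2)] D(3) eq by simp
  moreover have "open (chart_overlap c c' \<inter> chart_overlap c c'')"
    using chart_overlap_open[OF assms(1,2,3)] chart_overlap_open[OF assms(1,2,4)] by blast
  moreover have "snd c p \<in> chart_overlap c c' \<inter> chart_overlap c c''"
    using assms by (auto simp: chart_overlap_def)
  moreover have "(transition c' c'' \<circ> transition c c') u = transition c c'' u"
    if u: "u \<in> chart_overlap c c' \<inter> chart_overlap c c''" for u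
  proof -
    obtain q where q: "q \<in> fst c" "q \<in> fst c'" "u = snd c q"
      using u by (auto simp: chart_overlap_def)
    then show ?thesis
      using transition_chart[OF assms(1,2), of q] transition_chart[OF assms(1,3), of q] by simp
  qed
  ultimately have "(transition c c'' has_derivative ?D2 \<circ> ?D c c') (at (snd c p))"
    by (rule has_derivative_transform_within_open)
  then have "?D c c'' = ?D2 \<circ> ?D c c'"
    using D(1) has_derivative_unique by blast
  moreover have "linear (?D c c')" "linear ?D2"
    using D(2,3)[THEN has_derivative_linear] .
  ultimately show ?thesis
    unfolding jacobian_def by (simp add: matrix_compose)
qed

lemma jacobian_transition_self:
  fixes \<A> :: "('a, real^'n) chart set"
  assumes "smooth_atlas X \<A>" "c \<in> \<A>" "p \<in> fst c"
  shows "jacobian (transition c c) (at (snd c p)) = mat 1"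
proof -
  have "((\<lambda>u. u) has_derivative (\<lambda>u. u)) (at (snd c p))" by simp
  moreover have "open (chart_overlap c c)" "snd c p \<in> chart_overlap c c"
    using chart_overlap_open[OF assms(1,2,2)] assms(3) by (auto simp: chart_overlap_def)
  moreover have "u = transition c c u" if u: "u \<in> chart_overlap c c" for u
    using u transition_chart[OF assms(1,2), of _ c] by (auto simp: chart_overlap_def)
  ultimately have "(transition c c has_derivative (\<lambda>u. u)) (at (snd c p))"
    by (rule has_derivative_transform_within_open)
  then have "frechet_derivative (transition c c) (at (snd c p)) = (\<lambda>u. u)"
    by (metis frechet_derivative_at)
  then show ?thesis
    unfolding jacobian_def using matrix_id_mat_1 by (simp add: id_def)
qed

lemma jet_chart_image:
  fixes \<A> :: "('a, real^'p) chart set" and \<B> :: "('b, real^'n) chart set"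
  assumes A: "smooth_atlas T \<A>" and B: "smooth_atlas M \<B>" and c: "c \<in> \<A>" and d: "d \<in> \<B>"
  shows "chart_image (jet_chart T \<A> M \<B> c d) = chart_image c \<times> chart_image d \<times> UNIV"
proof
  show "chart_image (jet_chart T \<A> M \<B> c d) \<subseteq> chart_image c \<times> chart_image d \<times> UNIV"
    by (auto simp: chart_image_def jet_chart_def)
  show "chart_image c \<times> chart_image d \<times> UNIV \<subseteq> chart_image (jet_chart T \<A> M \<B> c d)"
  proof clarify
    fix a b and Y :: "real^'p^'n"
    assume "a \<in> chart_image c" "b \<in> chart_image d"
    then obtain t x where t: "t \<in> fst c" "a = snd c t" and x: "x \<in> fst d" "b = snd d x"
      by (auto simp: chart_image_def)
    let ?J = "\<lambda>e e' p. jacobian (transition e e') (at (snd e p))"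
    define y where "y c' d' = (if c' \<in> \<A> \<and> d' \<in> \<B> \<and> t \<in> fst c' \<and> x \<in> fst d'
      then ?J d d' x ** Y ** ?J c' c t else 0)" for c' d'
    have top: "t \<in> topspace T" "x \<in> topspace M"
      using A B c d t x by (auto simp: smooth_atlas_def)
    have law: "y c2 d2 = ?J d1 d2 x ** y c1 d1 ** ?J c2 c1 t"
      if "c1 \<in> \<A>" "c2 \<in> \<A>" "d1 \<in> \<B>" "d2 \<in> \<B>" "t \<in> fst c1 \<inter> fst c2" "x \<in> fst d1 \<inter> fst d2"
      for c1 c2 d1 d2
    proof -
      have t': "t \<in> fst c1" "t \<in> fst c2" and x': "x \<in> fst d1" "x \<in> fst d2"
        using that by auto
      have J: "?J d d2 x = ?J d1 d2 x ** ?J d d1 x" "?J c2 c t = ?J c1 c t ** ?J c2 c1 t"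
        using jacobian_transition_comp[OF B d that(3,4) x(1) x']
          jacobian_transition_comp[OF A that(2,1) c t'(2,1) t(1)] .
      have "y c1 d1 = ?J d d1 x ** Y ** ?J c1 c t" "y c2 d2 = ?J d d2 x ** Y ** ?J c2 c t"
        using that t' x' by (simp_all only: y_def simp_thms if_True)
      then show ?thesis
        by (simp only: J matrix_mul_assoc)
    qed
    have "\<not> (c' \<in> \<A> \<and> d' \<in> \<B> \<and> t \<in> fst c' \<and> x \<in> fst d') \<Longrightarrow> y c' d' = 0" for c' d'
      by (simp only: y_def if_False)
    with top law have "(t, x, y) \<in> J1 T \<A> M \<B>"
      unfolding J1_def mem_Collect_eq prod.case by blast
    moreover have "y c d = Y"
      using c d t x jacobian_transition_self[OF A c] jacobian_transition_self[OF B d]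
      by (simp add: y_def)
    ultimately show "(a, b, Y) \<in> chart_image (jet_chart T \<A> M \<B> c d)"
      using t x unfolding chart_image_def jet_chart_def by force
  qed
qed

lemma J1_law:
  assumes "(t, x, y) \<in> J1 T \<A> M \<B>" "c \<in> \<A>" "c' \<in> \<A>" "d \<in> \<B>" "d' \<in> \<B>"
    "t \<in> fst c" "t \<in> fst c'" "x \<in> fst d" "x \<in> fst d'"
  shows "y c' d' = jacobian (transition d d') (at (snd d x)) ** y c d
                     ** jacobian (transition c' c) (at (snd c' t))"
proof -
  have "\<forall>c\<in>\<A>. \<forall>c'\<in>\<A>. \<forall>d\<in>\<B>. \<forall>d'\<in>\<B>.
        t \<in> fst c \<inter> fst c' \<longrightarrow> x \<in> fst d \<inter> fst d' \<longrightarrow>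
        y c' d' = jacobian (transition d d') (at (snd d x)) ** y c d
                    ** jacobian (transition c' c) (at (snd c' t))"
    using assms(1) unfolding J1_def by blast
  then show ?thesis using assms(2-) by blast
qed

lemma jet_chart_inj:
  fixes \<A> :: "('a, real^'p) chart set" and \<B> :: "('b, real^'n) chart set"
  assumes A: "smooth_atlas T \<A>" and B: "smooth_atlas M \<B>" and c: "c \<in> \<A>" and d: "d \<in> \<B>"
  shows "inj_on (snd (jet_chart T \<A> M \<B> c d)) (fst (jet_chart T \<A> M \<B> c d))"
proof (rule inj_onI)
  fix j j'
  assume jj: "j \<in> fst (jet_chart T \<A> M \<B> c d)" "j' \<in> fst (jet_chart T \<A> M \<B> c d)"
    "snd (jet_chart T \<A> M \<B> c d) j = snd (jet_chart T \<A> M \<B> c d) j'"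
  obtain t x y t' x' y' where j_eq: "j = (t, x, y)" "j' = (t', x', y')"
    by (cases j, cases j') auto
  note j = jj(1)[unfolded j_eq] and j' = jj(2)[unfolded j_eq] and eq = jj(3)[unfolded j_eq]
  have tx: "t' = t" "x' = x" and yy: "y' c d = y c d"
    using j j' eq chart_inj[OF A c] chart_inj[OF B d]
    by (auto simp: jet_chart_def inj_on_def)
  have J: "(t, x, y) \<in> J1 T \<A> M \<B>" "(t, x, y') \<in> J1 T \<A> M \<B>" "t \<in> fst c" "x \<in> fst d"
    using j j' tx by (auto simp: jet_chart_def)
  have "y e f = y' e f" for e f
  proof (cases "e \<in> \<A> \<and> f \<in> \<B> \<and> t \<in> fst e \<and> x \<in> fst f")
    case True
    let ?R = "\<lambda>Y. jacobian (transition d f) (at (snd d x)) ** Y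
                    ** jacobian (transition e c) (at (snd e t))"
    have "y e f = ?R (y c d)" "y' e f = ?R (y' c d)"
      using True J c d by (auto intro: J1_law)
    then show ?thesis using yy by simp
  next
    case False
    have "y e f = 0" "y' e f = 0"
      using J(1,2) False unfolding J1_def by blast+
    then show ?thesis by simp
  qed
  then have "y = y'" by (intro ext)
  then show "j = j'" using tx j_eq by simp
qed


section \<open>Local differential geometry in coordinates\<close>

text \<open>Derivative in the coordinate direction \<open>b \<in> Basis\<close>.\<close>

definition partial_deriv :: "'e::euclidean_space \<Rightarrow> ('e \<Rightarrow> real) \<Rightarrow> 'e \<Rightarrow> real" where
  "partial_deriv b f u = deriv (\<lambda>s. f (u + s *\<^sub>R b)) 0"

definition vf_apply :: "('e::euclidean_space \<Rightarrow> 'e) \<Rightarrow> ('e \<Rightarrow> real) \<Rightarrow> 'e \<Rightarrow> real" where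
  "vf_apply X f u = (\<Sum>b\<in>Basis. (X u \<bullet> b) * partial_deriv b f u)"

definition lie_bracket ::
  "('e::euclidean_space \<Rightarrow> 'e) \<Rightarrow> ('e \<Rightarrow> 'e) \<Rightarrow> 'e \<Rightarrow> 'e" where
  "lie_bracket X Y u =
     (\<Sum>b\<in>Basis. (vf_apply X (\<lambda>u. Y u \<bullet> b) u - vf_apply Y (\<lambda>u. X u \<bullet> b) u) *\<^sub>R b)"

text \<open>\<open>christoffel g k i j\<close> is \<open>\<gamma>\<^sup>k\<^sub>i\<^sub>j\<close>, and \<open>riemann g l i j k\<close> is \<open>r\<^sup>l\<^sub>i\<^sub>j\<^sub>k\<close>.\<close>

definition christoffel ::
  "(real^'n \<Rightarrow> real^'n^'n) \<Rightarrow> 'n \<Rightarrow> 'n \<Rightarrow> 'n \<Rightarrow> real^'n \<Rightarrow> real" where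
  "christoffel g k i j x = (\<Sum>l\<in>UNIV. matrix_inv (g x) $ k $ l / 2 *
     (partial_deriv (axis j 1) (\<lambda>x. g x $ l $ i) x
      + partial_deriv (axis i 1) (\<lambda>x. g x $ l $ j) x
      - partial_deriv (axis l 1) (\<lambda>x. g x $ i $ j) x))"

definition riemann ::
  "(real^'n \<Rightarrow> real^'n^'n) \<Rightarrow> 'n \<Rightarrow> 'n \<Rightarrow> 'n \<Rightarrow> 'n \<Rightarrow> real^'n \<Rightarrow> real" where
  "riemann g l i j k x =
     partial_deriv (axis k 1) (christoffel g l i j) x
     - partial_deriv (axis j 1) (christoffel g l i k) x
     + (\<Sum>s\<in>UNIV. christoffel g s i j x * christoffel g l s k x)
     - (\<Sum>s\<in>UNIV. christoffel g s i k x * christoffel g l s j x)"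

definition ricci ::
  "(real^'n \<Rightarrow> real^'n^'n) \<Rightarrow> 'n \<Rightarrow> 'n \<Rightarrow> real^'n \<Rightarrow> real" where
  "ricci g i j x = (\<Sum>k\<in>UNIV. riemann g k i j k x)"

definition ricci_mixed ::
  "(real^'n \<Rightarrow> real^'n^'n) \<Rightarrow> 'n \<Rightarrow> 'n \<Rightarrow> real^'n \<Rightarrow> real" where
  "ricci_mixed g m j x = (\<Sum>i\<in>UNIV. matrix_inv (g x) $ m $ i * ricci g i j x)"

definition scalar_curv :: "(real^'n \<Rightarrow> real^'n^'n) \<Rightarrow> real^'n \<Rightarrow> real" where
  "scalar_curv g x = (\<Sum>i\<in>UNIV. \<Sum>j\<in>UNIV. matrix_inv (g x) $ i $ j * ricci g i j x)"

definition kdelta :: "'i \<Rightarrow> 'i \<Rightarrow> real" where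
  "kdelta i j = (if i = j then 1 else 0)"


section \<open>Geometry of the 1-jet bundle in an induced chart\<close>

text \<open>\<open>Vertical i \<alpha>\<close> is the index of \<open>\<partial>/\<partial>x\<^sup>i\<^sub>\<alpha>\<close>.\<close>

datatype ('p, 'n) jidx = Temporal 'p | Spatial 'n | Vertical 'n 'p

instance jidx :: (finite, finite) finite
proof
  have "(UNIV :: ('a, 'b) jidx set) =
      range Temporal \<union> range Spatial \<union> (\<lambda>(i, \<alpha>). Vertical i \<alpha>) ` UNIV"
    by (auto simp: image_iff) (metis jidx.exhaust)
  then show "finite (UNIV :: ('a, 'b) jidx set)"
    by (metis finite_UnI finite_imageI finite)
qed

context
  fixes h :: "real^'p \<Rightarrow> real^'p^'p"
    and g :: "real^'n \<Rightarrow> real^'n^'n"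
    and U :: "(real^'p) \<times> (real^'n) \<Rightarrow> real^'p^'n"
begin

text \<open>\<open>U (t, x) $ i $ \<alpha>\<close> is \<open>U\<^sup>(\<^sup>\<alpha>\<^sup>)\<^sub>(\<^sub>i\<^sub>)\<close>; \<open>U_curl \<alpha> i j\<close> is \<open>U\<^sup>(\<^sup>\<alpha>\<^sup>)\<^sub>(\<^sub>i\<^sub>)\<^sub>j\<close>.\<close>

definition U_curl :: "'p \<Rightarrow> 'n \<Rightarrow> 'n \<Rightarrow> (real^'p) \<times> (real^'n) \<Rightarrow> real" where
  "U_curl \<alpha> i j u = partial_deriv (0, axis j 1) (\<lambda>u. U u $ i $ \<alpha>) u
                   - partial_deriv (0, axis i 1) (\<lambda>u. U u $ j $ \<alpha>) u"

text \<open>\<open>M_conn i \<alpha> \<beta>\<close> is \<open>M\<^sup>(\<^sup>i\<^sup>)\<^sub>(\<^sub>\<alpha>\<^sub>)\<^sub>\<beta>\<close> and \<open>N_conn i \<alpha> j\<close> is \<open>N\<^sup>(\<^sup>i\<^sup>)\<^sub>(\<^sub>\<alpha>\<^sub>)\<^sub>j\<close>.\<close>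

definition M_conn :: "'n \<Rightarrow> 'p \<Rightarrow> 'p \<Rightarrow> ('p, 'n) jcoord \<Rightarrow> real" where
  "M_conn i \<alpha> \<beta> = (\<lambda>(t, x, y). - (\<Sum>\<gamma>\<in>UNIV. christoffel h \<gamma> \<alpha> \<beta> t * y $ i $ \<gamma>))"

definition N_conn :: "'n \<Rightarrow> 'p \<Rightarrow> 'n \<Rightarrow> ('p, 'n) jcoord \<Rightarrow> real" where
  "N_conn i \<alpha> j = (\<lambda>(t, x, y).
     (\<Sum>k\<in>UNIV. christoffel g i j k x * y $ k $ \<alpha>)
     + (\<Sum>\<gamma>\<in>UNIV. \<Sum>l\<in>UNIV.
          h t $ \<alpha> $ \<gamma> * matrix_inv (g x) $ i $ l / 4 * U_curl \<gamma> l j (t, x)))"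

fun frame :: "('p, 'n) jidx \<Rightarrow> ('p, 'n) jcoord \<Rightarrow> ('p, 'n) jcoord" where
  "frame (Temporal \<alpha>) z = (axis \<alpha> 1, 0, \<chi> j \<beta>. - M_conn j \<beta> \<alpha> z)"
| "frame (Spatial i) z = (0, axis i 1, \<chi> j \<beta>. - N_conn j \<beta> i z)"
| "frame (Vertical i \<alpha>) z = (0, 0, axis i (axis \<alpha> 1))"

fun coframe :: "('p, 'n) jidx \<Rightarrow> ('p, 'n) jcoord \<Rightarrow> ('p, 'n) jcoord \<Rightarrow> real" where
  "coframe (Temporal \<alpha>) z (dt, dx, dy) = dt $ \<alpha>"
| "coframe (Spatial i) z (dt, dx, dy) = dx $ i"
| "coframe (Vertical i \<alpha>) z (dt, dx, dy) =
     dy $ i $ \<alpha> + (\<Sum>\<beta>\<in>UNIV. M_conn i \<alpha> \<beta> z * dt $ \<beta>) + (\<Sum>j\<in>UNIV. N_conn i \<alpha> j z * dx $ j)"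

text \<open>\<open>cartan_coeff D A B\<close> is the \<open>X\<^sub>D\<close>-component of \<open>\<nabla>\<^bsub>X\<^sub>B\<^esub> X\<^sub>A\<close>: the differentiating
  index comes last.\<close>

fun cartan_coeff ::
  "('p, 'n) jidx \<Rightarrow> ('p, 'n) jidx \<Rightarrow> ('p, 'n) jidx \<Rightarrow> ('p, 'n) jcoord \<Rightarrow> real" where
  "cartan_coeff (Temporal \<beta>) (Temporal \<alpha>) (Temporal \<gamma>) (t, x, y) = christoffel h \<beta> \<alpha> \<gamma> t"
| "cartan_coeff (Vertical k \<beta>) (Vertical i \<alpha>) (Temporal \<gamma>) (t, x, y) =
     - christoffel h \<alpha> \<beta> \<gamma> t * kdelta k i"
| "cartan_coeff (Spatial k) (Spatial i) (Spatial j) (t, x, y) = christoffel g k i j x"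
| "cartan_coeff (Vertical k \<beta>) (Vertical i \<alpha>) (Spatial j) (t, x, y) =
     christoffel g k i j x * kdelta \<alpha> \<beta>"
| "cartan_coeff _ _ _ _ = 0"

definition nabla ::
  "(('p, 'n) jcoord \<Rightarrow> ('p, 'n) jcoord) \<Rightarrow> (('p, 'n) jcoord \<Rightarrow> ('p, 'n) jcoord)
   \<Rightarrow> ('p, 'n) jcoord \<Rightarrow> ('p, 'n) jcoord" where
  "nabla X Y z = (\<Sum>D\<in>UNIV.
     (vf_apply X (\<lambda>z. coframe D z (Y z)) z
      + (\<Sum>A\<in>UNIV. \<Sum>B\<in>UNIV. cartan_coeff D A B z * coframe A z (Y z) * coframe B z (X z)))
     *\<^sub>R frame D z)"

definition curvature ::
  "(('p, 'n) jcoord \<Rightarrow> ('p, 'n) jcoord) \<Rightarrow> (('p, 'n) jcoord \<Rightarrow> ('p, 'n) jcoord)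
   \<Rightarrow> (('p, 'n) jcoord \<Rightarrow> ('p, 'n) jcoord) \<Rightarrow> ('p, 'n) jcoord \<Rightarrow> ('p, 'n) jcoord" where
  "curvature X Y Z z =
     nabla X (nabla Y Z) z - nabla Y (nabla X Z) z - nabla (lie_bracket X Y) Z z"

text \<open>\<open>curv_comp D A B C\<close> is \<open>R\<^sup>D\<^sub>A\<^sub>B\<^sub>C\<close>, the \<open>X\<^sub>D\<close>-component of \<open>R(X\<^sub>C, X\<^sub>B) X\<^sub>A\<close>.\<close>

definition curv_comp ::
  "('p, 'n) jidx \<Rightarrow> ('p, 'n) jidx \<Rightarrow> ('p, 'n) jidx \<Rightarrow> ('p, 'n) jidx
   \<Rightarrow> ('p, 'n) jcoord \<Rightarrow> real" where
  "curv_comp D A B C z = coframe D z (curvature (frame C) (frame B) (frame A) z)"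

definition Ric :: "('p, 'n) jidx \<Rightarrow> ('p, 'n) jidx \<Rightarrow> ('p, 'n) jcoord \<Rightarrow> real" where
  "Ric A B z = (\<Sum>D\<in>UNIV. curv_comp D A B D z)"

definition G_potential ::
  "('p, 'n) jcoord \<Rightarrow> ('p, 'n) jcoord \<Rightarrow> ('p, 'n) jcoord \<Rightarrow> real" where
  "G_potential = (\<lambda>(t, x, y) v w.
     (\<Sum>\<alpha>\<in>UNIV. \<Sum>\<beta>\<in>UNIV. h t $ \<alpha> $ \<beta> *
        coframe (Temporal \<alpha>) (t, x, y) v * coframe (Temporal \<beta>) (t, x, y) w)
     + (\<Sum>i\<in>UNIV. \<Sum>j\<in>UNIV. g x $ i $ j *
        coframe (Spatial i) (t, x, y) v * coframe (Spatial j) (t, x, y) w)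
     + (\<Sum>\<alpha>\<in>UNIV. \<Sum>\<beta>\<in>UNIV. \<Sum>i\<in>UNIV. \<Sum>j\<in>UNIV.
        matrix_inv (h t) $ \<alpha> $ \<beta> * g x $ i $ j *
        coframe (Vertical i \<alpha>) (t, x, y) v * coframe (Vertical j \<beta>) (t, x, y) w))"

definition G_comp :: "('p, 'n) jidx \<Rightarrow> ('p, 'n) jidx \<Rightarrow> ('p, 'n) jcoord \<Rightarrow> real" where
  "G_comp A B z = G_potential z (frame A z) (frame B z)"

definition G_inv :: "('p, 'n) jidx \<Rightarrow> ('p, 'n) jidx \<Rightarrow> ('p, 'n) jcoord \<Rightarrow> real" where
  "G_inv A B z = matrix_inv (\<chi> A B. G_comp A B z) $ A $ B"

definition Sc :: "('p, 'n) jcoord \<Rightarrow> real" where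
  "Sc z = (\<Sum>A\<in>UNIV. \<Sum>B\<in>UNIV. G_inv A B z * Ric A B z)"

text \<open>In the following \<open>\<T> z\<close> is a bilinear form on coordinate vectors at \<open>z\<close>.\<close>

definition einstein_at ::
  "real \<Rightarrow> (('p, 'n) jcoord \<Rightarrow> ('p, 'n) jcoord \<Rightarrow> ('p, 'n) jcoord \<Rightarrow> real)
   \<Rightarrow> ('p, 'n) jcoord \<Rightarrow> bool" where
  "einstein_at \<K> \<T> z \<longleftrightarrow>
     (\<forall>A B. Ric A B z - Sc z / 2 * G_comp A B z = \<K> * \<T> z (frame A z) (frame B z))"

definition mixed ::
  "(('p, 'n) jcoord \<Rightarrow> ('p, 'n) jcoord \<Rightarrow> ('p, 'n) jcoord \<Rightarrow> real)
   \<Rightarrow> ('p, 'n) jidx \<Rightarrow> ('p, 'n) jidx \<Rightarrow> ('p, 'n) jcoord \<Rightarrow> real" where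
  "mixed \<T> B A z = (\<Sum>D\<in>UNIV. G_inv B D z * \<T> z (frame D z) (frame A z))"

text \<open>\<open>cov_deriv S B A E\<close> is \<open>(\<nabla>\<^bsub>X\<^sub>E\<^esub> S)\<^sup>B\<^sub>A\<close> for a \<open>(1,1)\<close> tensor with adapted components
  \<open>S B A = S\<^sup>B\<^sub>A\<close>.\<close>

definition cov_deriv ::
  "(('p, 'n) jidx \<Rightarrow> ('p, 'n) jidx \<Rightarrow> ('p, 'n) jcoord \<Rightarrow> real)
   \<Rightarrow> ('p, 'n) jidx \<Rightarrow> ('p, 'n) jidx \<Rightarrow> ('p, 'n) jidx \<Rightarrow> ('p, 'n) jcoord \<Rightarrow> real" where
  "cov_deriv S B A E z = vf_apply (frame E) (S B A) z
     + (\<Sum>C\<in>UNIV. S C A z * cartan_coeff B C E z)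
     - (\<Sum>C\<in>UNIV. S B C z * cartan_coeff C A E z)"

definition conservation_at ::
  "(('p, 'n) jcoord \<Rightarrow> ('p, 'n) jcoord \<Rightarrow> ('p, 'n) jcoord \<Rightarrow> real)
   \<Rightarrow> ('p, 'n) jcoord \<Rightarrow> bool" where
  "conservation_at \<T> z \<longleftrightarrow> (\<forall>A. (\<Sum>B\<in>UNIV. cov_deriv (mixed \<T>) B A B z) = 0)"

text \<open>\<open>t_cov_deriv S \<mu> \<beta> \<nu>\<close> is \<open>S\<^sup>\<mu>\<^sub>\<beta>\<close> differentiated along \<open>\<delta>/\<delta>t\<^sup>\<nu>\<close>, and
  \<open>x_cov_deriv S m j k\<close> is \<open>S\<^sup>m\<^sub>j\<close> differentiated along \<open>\<delta>/\<delta>x\<^sup>k\<close>.\<close>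

definition t_cov_deriv ::
  "('p \<Rightarrow> 'p \<Rightarrow> ('p, 'n) jcoord \<Rightarrow> real) \<Rightarrow> 'p \<Rightarrow> 'p \<Rightarrow> 'p \<Rightarrow> ('p, 'n) jcoord \<Rightarrow> real" where
  "t_cov_deriv S \<mu> \<beta> \<nu> z = vf_apply (frame (Temporal \<nu>)) (S \<mu> \<beta>) z
     + (\<Sum>\<gamma>\<in>UNIV. S \<gamma> \<beta> z * christoffel h \<mu> \<gamma> \<nu> (fst z))
     - (\<Sum>\<gamma>\<in>UNIV. S \<mu> \<gamma> z * christoffel h \<gamma> \<beta> \<nu> (fst z))"

definition x_cov_deriv ::
  "('n \<Rightarrow> 'n \<Rightarrow> ('p, 'n) jcoord \<Rightarrow> real) \<Rightarrow> 'n \<Rightarrow> 'n \<Rightarrow> 'n \<Rightarrow> ('p, 'n) jcoord \<Rightarrow> real" where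
  "x_cov_deriv S m j k z = vf_apply (frame (Spatial k)) (S m j) z
     + (\<Sum>l\<in>UNIV. S l j z * christoffel g m l k (fst (snd z)))
     - (\<Sum>l\<in>UNIV. S m l z * christoffel g l j k (fst (snd z)))"

definition reduced_at :: "('p, 'n) jcoord \<Rightarrow> bool" where
  "reduced_at z \<longleftrightarrow>
     (\<forall>\<beta>. (\<Sum>\<mu>\<in>UNIV. t_cov_deriv (\<lambda>\<mu> \<beta> (t, x, y).
        ricci_mixed h \<mu> \<beta> t - (scalar_curv h t + scalar_curv g x) / 2 * kdelta \<mu> \<beta>)
        \<mu> \<beta> \<mu> z) = 0) \<and>
     (\<forall>j. (\<Sum>m\<in>UNIV. x_cov_deriv (\<lambda>m j (t, x, y).
        ricci_mixed g m j x - (scalar_curv h t + scalar_curv g x) / 2 * kdelta m j)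
        m j m z) = 0)"

definition lagrangian :: "('p, 'n) jcoord \<Rightarrow> real" where
  "lagrangian = (\<lambda>(t, x, y).
     (\<Sum>\<alpha>\<in>UNIV. \<Sum>\<beta>\<in>UNIV. \<Sum>i\<in>UNIV. \<Sum>j\<in>UNIV.
        matrix_inv (h t) $ \<alpha> $ \<beta> * g x $ i $ j * y $ i $ \<alpha> * y $ j $ \<beta>)
     + (\<Sum>\<alpha>\<in>UNIV. \<Sum>i\<in>UNIV. U (t, x) $ i $ \<alpha> * y $ i $ \<alpha>))"

end


section \<open>Metrical multi-time Lagrange spaces of electrodynamics\<close>

text \<open>The d-tensor \<open>U\<close> depends on the points of \<open>T\<close> and \<open>M\<close> only; \<open>U c d\<close> is its component
  matrix in the induced chart.\<close>

definition d_tensor_U ::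
  "('a, real^'p) chart set \<Rightarrow> ('b, real^'n) chart set
   \<Rightarrow> (('a, real^'p) chart \<Rightarrow> ('b, real^'n) chart \<Rightarrow> (real^'p) \<times> (real^'n) \<Rightarrow> real^'p^'n)
   \<Rightarrow> bool" where
  "d_tensor_U \<A> \<B> U \<longleftrightarrow>
     (\<forall>c\<in>\<A>. \<forall>d\<in>\<B>. smooth_on (chart_image c \<times> chart_image d) (U c d)) \<and>
     (\<forall>c\<in>\<A>. \<forall>c'\<in>\<A>. \<forall>d\<in>\<B>. \<forall>d'\<in>\<B>. \<forall>t\<in>chart_overlap c c'. \<forall>x\<in>chart_overlap d d'. \<forall>\<alpha> i.
        U c d (t, x) $ i $ \<alpha> = (\<Sum>\<beta>\<in>UNIV. \<Sum>j\<in>UNIV.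
          jacobian (transition c' c) (at (transition c c' t)) $ \<alpha> $ \<beta> *
          jacobian (transition d d') (at x) $ j $ i *
          U c' d' (transition c c' t, transition d d' x) $ j $ \<beta>))"

definition EDML ::
  "'a topology \<Rightarrow> ('a, real^'p) chart set \<Rightarrow> 'b topology \<Rightarrow> ('b, real^'n) chart set
   \<Rightarrow> ('a, real^'p) tensor_field2 \<Rightarrow> ('b, real^'n) tensor_field2
   \<Rightarrow> (('a, real^'p) chart \<Rightarrow> ('b, real^'n) chart \<Rightarrow> (real^'p) \<times> (real^'n) \<Rightarrow> real^'p^'n)
   \<Rightarrow> ('a \<times> 'b \<Rightarrow> real) \<Rightarrow> (('a, 'b, 'p, 'n) jet \<Rightarrow> real) \<Rightarrow> bool" where
  "EDML T \<A> M \<B> h g U F L \<longleftrightarrow>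
     smooth_manifold T \<A> \<and> smooth_manifold M \<B> \<and>
     semi_riemannian \<A> h \<and> semi_riemannian \<B> g \<and> d_tensor_U \<A> \<B> U \<and>
     (\<forall>c\<in>\<A>. \<forall>d\<in>\<B>. smooth_on (chart_image c \<times> chart_image d)
        (\<lambda>(t, x). F (inv_into (fst c) (snd c) t, inv_into (fst d) (snd d) x))) \<and>
     (\<forall>c\<in>\<A>. \<forall>d\<in>\<B>. \<forall>(t, x, y) \<in> fst (jet_chart T \<A> M \<B> c d).
        L (t, x, y) =
          lagrangian (\<lambda>t. comps (h c t)) (\<lambda>x. comps (g d x)) (U c d)
            (snd (jet_chart T \<A> M \<B> c d) (t, x, y)) + F (t, x))"

end

theory Submission
  imports Defs
begin

text \<open>The Lie bracket of two adapted frame fields is vertical and the Cartan connection has no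
  coefficients in vertical directions, so the bracket term drops out of the curvature on the frame.
  Hence neither the nonlinear connection nor \<open>U\<close> enters the curvature, and the Ricci tensor is block
  diagonal with blocks \<open>H\<^sub>\<alpha>\<^sub>\<beta>\<close>, \<open>r\<^sub>i\<^sub>j\<close> and \<open>0\<close>. By the Einstein equations \<open>\<K> \<T>\<^sup>B\<^sub>A\<close> is block diagonal as well,
  with vertical block a multiple of \<open>H + r\<close>. This block does not depend on the fibre coordinates, so
  its divergence vanishes, and the remaining two divergences are the displayed ones. Smoothness of
  the metrics is needed only to move the constant \<open>\<K>\<close> out of the derivatives, as \<open>deriv\<close>
  is arbitrary at points where a function is not differentiable.\<close>

section \<open>Calculus of smooth functions\<close>

text \<open>Differentiability and the derivative at a point of an open set depend only on the germ
  there, so the derivatives agree on \<open>S\<close> again; the induction therefore varies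
  \<open>f\<close> and \<open>g\<close>. The derivative rules for sums, products and inverses hold
  only on \<open>S\<close> and are substituted through this lemma.\<close>

lemma Ck_on_cong:
  assumes "open S" "\<And>x. x \<in> S \<Longrightarrow> f x = g x"
  shows "Ck_on k S f \<longleftrightarrow> Ck_on k S g"
  using assms(2)
proof (induction k arbitrary: f g)
  case 0
  then show ?case by (simp cong: continuous_on_cong)
next
  case (Suc k)
  have tr: "(f has_derivative f') (at x) \<longleftrightarrow> (g has_derivative f') (at x)" if "x \<in> S" for x f'
    using Suc.prems that by (metis assms(1) has_derivative_transform_within_open)
  have "f differentiable (at x) \<longleftrightarrow> g differentiable (at x)"
    "frechet_derivative f (at x) = frechet_derivative g (at x)" if "x \<in> S" for x
    using tr[OF that] by (simp_all add: differentiable_def frechet_derivative_def)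
  moreover from this have "Ck_on k S (\<lambda>x. frechet_derivative f (at x) v) \<longleftrightarrow>
      Ck_on k S (\<lambda>x. frechet_derivative g (at x) v)" for v
    by (intro Suc.IH) simp
  ultimately show ?case by simp
qed

lemma Ck_on_SucD: "Ck_on (Suc k) S f \<Longrightarrow> Ck_on k S f"
proof (induction k arbitrary: f)
  case 0
  then show ?case
    by (simp add: continuous_at_imp_continuous_on differentiable_imp_continuous_within)
next
  case (Suc k)
  then show ?case by (metis Ck_on.simps(2))
qed

lemma Ck_on_const: "Ck_on k S (\<lambda>x. c)"
  by (induction k arbitrary: c) simp_all

lemma Ck_on_add:
  assumes "open S" "Ck_on k S f" "Ck_on k S g"
  shows "Ck_on k S (\<lambda>x. f x + g x)"
  using assms(2,3)
proof (induction k arbitrary: f g)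
  case 0
  then show ?case by (simp add: continuous_on_add)
next
  case (Suc k)
  have sum_rule: "frechet_derivative (\<lambda>x. f x + g x) (at x) v =
      frechet_derivative f (at x) v + frechet_derivative g (at x) v" if "x \<in> S" for x v
  proof -
    have "(f has_derivative frechet_derivative f (at x)) (at x)"
      "(g has_derivative frechet_derivative g (at x)) (at x)"
      using Suc.prems that frechet_derivative_works by (simp_all, blast+)
    from frechet_derivative_at[OF has_derivative_add[OF this]] show ?thesis
      by metis
  qed
  have "Ck_on k S (\<lambda>x. frechet_derivative (\<lambda>x. f x + g x) (at x) v)" for v
    using Suc by (subst Ck_on_cong[OF assms(1), where g =
      "\<lambda>x. frechet_derivative f (at x) v + frechet_derivative g (at x) v"])
      (simp_all add: sum_rule)
  then show ?case using Suc.prems by simp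
qed

text \<open>The product rule brings back the undifferentiated \<open>f\<close> and \<open>g\<close>,
  now at order \<open>k\<close>; \<open>Ck_on_SucD\<close> supplies this.\<close>

lemma Ck_on_mult:
  fixes f g :: "'a::real_normed_vector \<Rightarrow> real"
  assumes "open S" "Ck_on k S f" "Ck_on k S g"
  shows "Ck_on k S (\<lambda>x. f x * g x)"
  using assms(2,3)
proof (induction k arbitrary: f g)
  case 0
  then show ?case by (simp add: continuous_on_mult)
next
  case (Suc k)
  have "frechet_derivative (\<lambda>x. f x * g x) (at x) v =
      f x * frechet_derivative g (at x) v + frechet_derivative f (at x) v * g x"
    if "x \<in> S" for x v
  proof -
    have "(f has_derivative frechet_derivative f (at x)) (at x)"
      "(g has_derivative frechet_derivative g (at x)) (at x)"
      using Suc.prems that frechet_derivative_works by (simp_all, blast+)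
    from frechet_derivative_at[OF has_derivative_mult[OF this]] show ?thesis
      by metis
  qed
  then have "Ck_on k S (\<lambda>x. frechet_derivative (\<lambda>x. f x * g x) (at x) v)" for v
    using Suc.prems Suc.prems[THEN Ck_on_SucD] by (subst Ck_on_cong[OF assms(1), where g =
      "\<lambda>x. f x * frechet_derivative g (at x) v + frechet_derivative f (at x) v * g x"])
      (auto intro!: Ck_on_add Suc.IH assms(1))
  then show ?case using Suc.prems by simp
qed

text \<open>The derivative of \<open>1/f\<close> is a product of \<open>1/f\<close>,
  \<open>Df\<close> and \<open>1/f\<close>, so order \<open>k\<close> of the inverse itself gives
  order \<open>k + 1\<close>.\<close>

lemma Ck_on_inverse:
  fixes f :: "'a::real_normed_vector \<Rightarrow> real"
  assumes "open S" "Ck_on k S f" and nz: "\<And>x. x \<in> S \<Longrightarrow> f x \<noteq> 0"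
  shows "Ck_on k S (\<lambda>x. inverse (f x))"
  using assms(2)
proof (induction k)
  case 0
  then show ?case using nz by (simp add: continuous_on_inverse)
next
  case (Suc k)
  have D: "((\<lambda>x. inverse (f x)) has_derivative
      (\<lambda>v. - (inverse (f x) * frechet_derivative f (at x) v * inverse (f x)))) (at x)"
    if "x \<in> S" for x
  proof -
    have "(f has_derivative frechet_derivative f (at x)) (at x)"
      using Suc.prems that frechet_derivative_works by auto
    from Deriv.has_derivative_inverse[OF nz[OF that] this] show ?thesis .
  qed
  \<comment> \<open>The sign is written as a constant factor so that closure under products
    applies.\<close>
  then have "frechet_derivative (\<lambda>x. inverse (f x)) (at x) v =
      (- 1) * (inverse (f x) * frechet_derivative f (at x) v * inverse (f x))" if "x \<in> S" for x v
    by (simp flip: frechet_derivative_at[OF D[OF that]])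
  moreover have "Ck_on k S
      (\<lambda>x. (- 1) * (inverse (f x) * frechet_derivative f (at x) v * inverse (f x)))" for v
    using Suc Ck_on_SucD[OF Suc.prems] by (intro Ck_on_mult Ck_on_const assms(1)) auto
  ultimately have "Ck_on k S (\<lambda>x. frechet_derivative (\<lambda>x. inverse (f x)) (at x) v)" for v
    by (subst Ck_on_cong[OF assms(1)])
  then show ?case using D by (auto simp: differentiable_def)
qed

lemma smooth_on_const: "smooth_on S (\<lambda>x. c)"
  by (simp add: smooth_on_def Ck_on_const)

lemma smooth_on_add:
  "open S \<Longrightarrow> smooth_on S f \<Longrightarrow> smooth_on S g \<Longrightarrow> smooth_on S (\<lambda>x. f x + g x)"
  by (simp add: smooth_on_def Ck_on_add)

lemma smooth_on_mult:
  fixes f g :: "'a::real_normed_vector \<Rightarrow> real"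
  shows "open S \<Longrightarrow> smooth_on S f \<Longrightarrow> smooth_on S g \<Longrightarrow> smooth_on S (\<lambda>x. f x * g x)"
  by (simp add: smooth_on_def Ck_on_mult)

lemma smooth_on_diff:
  fixes f g :: "'a::real_normed_vector \<Rightarrow> real"
  shows "open S \<Longrightarrow> smooth_on S f \<Longrightarrow> smooth_on S g \<Longrightarrow> smooth_on S (\<lambda>x. f x - g x)"
  using smooth_on_add[of S f "\<lambda>x. (-1) * g x"] smooth_on_mult[of S "\<lambda>_. -1" g]
  by (simp add: smooth_on_const)

lemma smooth_on_divide:
  fixes f g :: "'a::real_normed_vector \<Rightarrow> real"
  assumes "open S" "smooth_on S f" "smooth_on S g" "\<And>x. x \<in> S \<Longrightarrow> g x \<noteq> 0"
  shows "smooth_on S (\<lambda>x. f x / g x)"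
  using smooth_on_mult[of S f "\<lambda>x. inverse (g x)"] assms
  by (simp add: smooth_on_def Ck_on_inverse divide_inverse)

lemma smooth_on_sum:
  assumes "open S" "\<And>i. i \<in> I \<Longrightarrow> smooth_on S (f i)"
  shows "smooth_on S (\<lambda>x. \<Sum>i\<in>I. f i x)"
  using assms
  by (induction I rule: infinite_finite_induct) (simp_all add: smooth_on_const smooth_on_add)

lemma smooth_on_prod:
  fixes f :: "'i \<Rightarrow> 'a::real_normed_vector \<Rightarrow> real"
  assumes "open S" "\<And>i. i \<in> I \<Longrightarrow> smooth_on S (f i)"
  shows "smooth_on S (\<lambda>x. \<Prod>i\<in>I. f i x)"
  using assms
  by (induction I rule: infinite_finite_induct) (simp_all add: smooth_on_const smooth_on_mult)

lemma smooth_on_differentiable: "smooth_on S f \<Longrightarrow> x \<in> S \<Longrightarrow> f differentiable (at x)"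
  unfolding smooth_on_def by (metis Ck_on.simps(2))

lemma partial_deriv_works:
  assumes "f differentiable (at u)"
  shows "((\<lambda>s. f (u + s *\<^sub>R b)) has_real_derivative frechet_derivative f (at u) b) (at 0)"
proof -
  let ?D = "frechet_derivative f (at u)"
  \<comment> \<open>The base point is written as the value of the line at \<open>s = 0\<close>, the
    form that the chain rule asks for.\<close>
  have D: "(f has_derivative ?D) (at (u + 0 *\<^sub>R b))"
    using assms frechet_derivative_works by auto
  have "((\<lambda>s. u + s *\<^sub>R b) has_derivative (\<lambda>s. s *\<^sub>R b)) (at 0)"
    by (auto intro!: derivative_eq_intros)
  from has_derivative_compose[OF this D]
  have "((\<lambda>s. f (u + s *\<^sub>R b)) has_derivative (\<lambda>s. ?D (s *\<^sub>R b))) (at 0)" .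
  moreover have "(\<lambda>s. ?D (s *\<^sub>R b)) = (*) (?D b)"
    using linear_frechet_derivative[OF assms] by (auto simp: linear_cmul)
  ultimately show ?thesis by (simp add: has_field_derivative_def)
qed

lemma partial_deriv_frechet:
  "f differentiable (at u) \<Longrightarrow> partial_deriv b f u = frechet_derivative f (at u) b"
  unfolding partial_deriv_def by (rule DERIV_imp_deriv[OF partial_deriv_works])

text \<open>On \<open>S\<close> the partial derivative is the Frechet derivative in a fixed
  direction; the lost order does not matter for smooth functions.\<close>

lemma smooth_on_partial_deriv:
  assumes "open S" "smooth_on S f"
  shows "smooth_on S (partial_deriv b f)"
  unfolding smooth_on_def
proof
  fix k
  have "Ck_on (Suc k) S f" using assms(2) by (simp only: smooth_on_def)
  then show "Ck_on k S (partial_deriv b f)"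
    by (subst Ck_on_cong[OF assms(1), where g = "\<lambda>x. frechet_derivative f (at x) b"])
      (simp_all add: partial_deriv_frechet)
qed

section \<open>Smoothness of determinants, inverse matrices and curvature quantities\<close>

lemma smooth_on_det:
  fixes A :: "'a::real_normed_vector \<Rightarrow> real^'n^'n"
  assumes "open S" "\<And>i j. smooth_on S (\<lambda>x. A x $ i $ j)"
  shows "smooth_on S (\<lambda>x. det (A x))"
  unfolding det_def using assms
  by (intro smooth_on_sum smooth_on_mult smooth_on_prod smooth_on_const)

lemma matrix_inv_mult:
  fixes A :: "real^'n^'n"
  assumes "det A \<noteq> 0"
  shows "A ** matrix_inv A = mat 1" "matrix_inv A ** A = mat 1"
proof -
  have "\<exists>B. A ** B = mat 1 \<and> B ** A = mat 1"
    using assms invertible_det_nz[of A] by (simp add: invertible_def)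
  then have "A ** matrix_inv A = mat 1 \<and> matrix_inv A ** A = mat 1"
    unfolding matrix_inv_def by (rule someI_ex)
  then show "A ** matrix_inv A = mat 1" "matrix_inv A ** A = mat 1" by auto
qed

lemma matrix_inv_unique:
  fixes A B :: "real^'n^'n"
  assumes "B ** A = mat 1"
  shows "matrix_inv A = B"
proof -
  have "det A \<noteq> 0"
    using assms invertible_det_nz[of A] invertible_left_inverse[of A] by blast
  from matrix_inv_mult(1)[OF this] show ?thesis
    by (metis assms matrix_mul_assoc matrix_mul_lid matrix_mul_rid)
qed

text \<open>Cramer's rule for the equation \<open>A x = axis l 1\<close>, whose solution is column
  \<open>l\<close> of the inverse. Entries of the inverse become quotients of determinants, hence
  smooth.\<close>

lemma matrix_inv_cramer:
  fixes A :: "real^'n^'n"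
  assumes "det A \<noteq> 0"
  shows "matrix_inv A $ k $ l =
    det (\<chi> i j. if j = k then axis l 1 $ i else A $ i $ j) / det A"
proof -
  have "A *v (matrix_inv A *v axis l 1) = axis l 1"
    using matrix_inv_mult[OF assms] by (simp add: matrix_vector_mul_assoc)
  then have "matrix_inv A *v axis l 1 =
      (\<chi> k. det (\<chi> i j. if j = k then axis l 1 $ i else A $ i $ j) / det A)"
    using cramer[OF assms] by blast
  moreover have "(matrix_inv A *v axis l 1) $ k = matrix_inv A $ k $ l"
    by (simp add: matrix_vector_mult_basis column_def)
  ultimately show ?thesis by simp
qed

lemma smooth_on_cong:
  "open S \<Longrightarrow> (\<And>x. x \<in> S \<Longrightarrow> f x = g x) \<Longrightarrow> smooth_on S f \<longleftrightarrow> smooth_on S g"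
  unfolding smooth_on_def by (metis Ck_on_cong)

lemma smooth_on_matrix_inv:
  fixes A :: "'a::real_normed_vector \<Rightarrow> real^'n^'n"
  assumes "open S" "\<And>i j. smooth_on S (\<lambda>x. A x $ i $ j)" "\<And>x. x \<in> S \<Longrightarrow> det (A x) \<noteq> 0"
  shows "smooth_on S (\<lambda>x. matrix_inv (A x) $ k $ l)"
proof -
  \<comment> \<open>The replaced column is constant and the other columns are those of
    \<open>A x\<close>.\<close>
  have "smooth_on S (\<lambda>x. (\<chi> i j. if j = k then axis l 1 $ i else A x $ i $ j) $ i $ j)" for i j
    using assms(2) by (cases "j = k") (simp_all add: smooth_on_const)
  then have "smooth_on S (\<lambda>x. det (\<chi> i j. if j = k then axis l 1 $ i else A x $ i $ j) / det (A x))"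
    by (intro smooth_on_divide smooth_on_det assms)
  then show ?thesis
    using assms(3) by (subst smooth_on_cong[OF assms(1)]) (simp_all add: matrix_inv_cramer)
qed

lemma smooth_on_christoffel:
  assumes "open S" "\<And>i j. smooth_on S (\<lambda>x. g x $ i $ j)" "\<And>x. x \<in> S \<Longrightarrow> det (g x) \<noteq> 0"
  shows "smooth_on S (christoffel g k i j)"
  unfolding christoffel_def[abs_def] using assms
  by (intro smooth_on_sum smooth_on_mult smooth_on_divide smooth_on_add smooth_on_diff
      smooth_on_partial_deriv smooth_on_matrix_inv smooth_on_const) auto

lemma smooth_on_ricci:
  assumes "open S" "\<And>i j. smooth_on S (\<lambda>x. g x $ i $ j)" "\<And>x. x \<in> S \<Longrightarrow> det (g x) \<noteq> 0"
  shows "smooth_on S (ricci g i j)"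
  unfolding ricci_def[abs_def] riemann_def using assms
  by (intro smooth_on_sum smooth_on_mult smooth_on_add smooth_on_diff
      smooth_on_partial_deriv smooth_on_christoffel) auto

lemma smooth_on_ricci_mixed:
  assumes "open S" "\<And>i j. smooth_on S (\<lambda>x. g x $ i $ j)" "\<And>x. x \<in> S \<Longrightarrow> det (g x) \<noteq> 0"
  shows "smooth_on S (ricci_mixed g i j)"
  unfolding ricci_mixed_def[abs_def] using assms
  by (intro smooth_on_sum smooth_on_mult smooth_on_matrix_inv smooth_on_ricci) auto

lemma smooth_on_scalar_curv:
  assumes "open S" "\<And>i j. smooth_on S (\<lambda>x. g x $ i $ j)" "\<And>x. x \<in> S \<Longrightarrow> det (g x) \<noteq> 0"
  shows "smooth_on S (scalar_curv g)"
  unfolding scalar_curv_def[abs_def] using assms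
  by (intro smooth_on_sum smooth_on_mult smooth_on_matrix_inv smooth_on_ricci) auto

text \<open>At a point without a derivative \<open>deriv\<close> returns an arbitrary value, which
  scaling need not respect; smoothness lets the constant factor come out.\<close>

lemma partial_deriv_divide:
  assumes "smooth_on S f" "u \<in> S"
  shows "partial_deriv b (\<lambda>u. f u / c) u = partial_deriv b f u / c"
proof -
  note D = partial_deriv_works[OF smooth_on_differentiable[OF assms], of b]
  show ?thesis
    unfolding partial_deriv_def
    using DERIV_imp_deriv[OF DERIV_cdivide[OF D, of c]] DERIV_imp_deriv[OF D] by simp
qed

section \<open>Curvature of the Cartan connection\<close>

text \<open>The three families of adapted indices are disjoint and exhaust the type. Contractions
  are split this way so that the zero blocks of the tensors and of the connection can remove
  terms.\<close>

lemma sum_jidx: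
  "(\<Sum>D\<in>UNIV. f (D :: ('p::finite, 'n::finite) jidx)) =
     (\<Sum>\<alpha>\<in>UNIV. f (Temporal \<alpha>)) + (\<Sum>i\<in>UNIV. f (Spatial i))
     + (\<Sum>i\<in>UNIV. \<Sum>\<alpha>\<in>UNIV. f (Vertical i \<alpha>))"
proof -
  have U: "(UNIV :: ('p, 'n) jidx set) =
      (range Temporal \<union> range Spatial) \<union> (\<lambda>(i, \<alpha>). Vertical i \<alpha>) ` (UNIV \<times> UNIV)"
    by (auto simp: image_iff) (metis jidx.exhaust)
  show ?thesis
    unfolding U
    by (subst sum.union_disjoint, auto)+
      (simp add: sum.reindex inj_on_def sum.cartesian_product split_beta)
qed

lemma sum_Basis_vec:
  "(\<Sum>b\<in>Basis. f (b :: real^'n)) = (\<Sum>i\<in>UNIV. f (axis i 1))"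
proof -
  have *: "(Basis :: (real^'n) set) = range (\<lambda>i. axis i 1)"
    by (auto simp: Basis_vec_def)
  show ?thesis
    unfolding * by (subst sum.reindex) (auto simp: inj_on_def axis_eq_axis)
qed

lemma sum_Basis_prod:
  "(\<Sum>b\<in>Basis. f (b :: 'a::euclidean_space \<times> 'b::euclidean_space)) =
     (\<Sum>b\<in>Basis. f (b, 0)) + (\<Sum>b\<in>Basis. f (0, b))"
  unfolding Basis_prod_def
  by (subst sum.union_disjoint) (auto simp: sum.reindex inj_on_def)

section \<open>Derivatives along the adapted fields\<close>

lemma partial_deriv_const [simp]: "partial_deriv b (\<lambda>u. c) u = 0"
  by (simp add: partial_deriv_def)

lemma partial_deriv_cong:
  assumes "open S" "u \<in> S" "\<And>v. v \<in> S \<Longrightarrow> f v = f' v"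
  shows "partial_deriv b f u = partial_deriv b f' u"
  unfolding partial_deriv_def
proof (rule deriv_cong_ev)
  have "open ((\<lambda>s. u + s *\<^sub>R b) -` S)"
    by (intro open_vimage assms continuous_intros)
  then have "\<forall>\<^sub>F s in nhds 0. s \<in> (\<lambda>s. u + s *\<^sub>R b) -` S"
    using assms(2) by (intro eventually_nhds_in_open) auto
  then show "\<forall>\<^sub>F s in nhds 0. f (u + s *\<^sub>R b) = f' (u + s *\<^sub>R b)"
    by eventually_elim (auto simp: assms(3))
qed simp

lemma vf_apply_const [simp]: "vf_apply X (\<lambda>z. c) z = 0"
  by (simp add: vf_apply_def)

lemma vf_apply_cong:
  assumes "open S" "z \<in> S" "\<And>v. v \<in> S \<Longrightarrow> f v = f' v"
  shows "vf_apply X f z = vf_apply X f' z"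
  unfolding vf_apply_def using partial_deriv_cong[OF assms] by simp

text \<open>The function is constant along the fibres, so the fibre components of \<open>X\<close>
  contribute nothing.\<close>

lemma vf_apply_base:
  fixes f :: "('p::finite, 'n::finite) jcoord \<Rightarrow> real"
  assumes "\<And>t x y. f (t, x, y) = F t x"
  shows "vf_apply X f (t, x, y) =
    (\<Sum>\<gamma>\<in>UNIV. fst (X (t, x, y)) $ \<gamma> * partial_deriv (axis \<gamma> 1) (\<lambda>t. F t x) t)
    + (\<Sum>i\<in>UNIV. fst (snd (X (t, x, y))) $ i * partial_deriv (axis i 1) (F t) x)"
proof -
  have "partial_deriv (b, 0) f (t, x, y) = partial_deriv b (\<lambda>t. F t x) t"
    "partial_deriv (0, b', 0) f (t, x, y) = partial_deriv b' (F t) x"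
    "partial_deriv (0, 0, b'') f (t, x, y) = 0" for b b' b''
    by (simp_all add: partial_deriv_def assms)
  then show ?thesis
    by (cases "X (t, x, y)") (simp add: vf_apply_def sum_Basis_prod sum_Basis_vec[where 'n='p]
        sum_Basis_vec[where 'n='n] inner_axis)
qed

text \<open>The nonlinear connection enters the adapted fields only through fibre components, so on
  functions of \<open>(t, x)\<close> they act as plain coordinate derivatives.\<close>

lemma vf_apply_frame:
  fixes f :: "('p::finite, 'n::finite) jcoord \<Rightarrow> real"
  assumes "\<And>t x y. f (t, x, y) = F t x"
  shows "vf_apply (frame h g U (Temporal \<gamma>)) f (t, x, y) = partial_deriv (axis \<gamma> 1) (\<lambda>t. F t x) t"
    and "vf_apply (frame h g U (Spatial i)) f (t, x, y) = partial_deriv (axis i 1) (F t) x"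
    and "vf_apply (frame h g U (Vertical j \<beta>)) f (t, x, y) = 0"
  unfolding vf_apply_base[of f F, OF assms]
  by (simp_all add: axis_def if_distrib if_distribR cong: if_cong)

section \<open>Duality of frame and coframe\<close>

lemma kdelta_simps [simp]: "kdelta i i = 1" "i \<noteq> j \<Longrightarrow> kdelta i j = 0"
  by (simp_all add: kdelta_def)

lemma sum_kdelta [simp]:
  "(\<Sum>j\<in>UNIV. f j * kdelta j (i::'i::finite)) = f i" "(\<Sum>j\<in>UNIV. f j * kdelta i j) = f i"
  "(\<Sum>j\<in>UNIV. kdelta j (i::'i::finite) * f j) = f i" "(\<Sum>j\<in>UNIV. kdelta i j * f j) = f i"
  by (simp_all add: kdelta_def if_distrib if_distribR cong: if_cong)

lemma linear_coframe: "linear (coframe h g U D z)"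
proof (rule linearI)
  fix u v :: "('a, 'b) jcoord" and r :: real
  show "coframe h g U D z (u + v) = coframe h g U D z u + coframe h g U D z v"
    by (cases D; cases u; cases v) (simp_all add: algebra_simps sum.distrib)
  show "coframe h g U D z (r *\<^sub>R u) = r *\<^sub>R coframe h g U D z u"
    by (cases D; cases u) (simp_all add: algebra_simps sum_distrib_left)
qed

lemma axis_nth_kdelta:
  "axis i 1 $ j = kdelta j i"
  "axis i (axis \<alpha> 1) $ j $ \<beta> = kdelta j i * kdelta \<beta> \<alpha>"
  by (simp_all add: axis_def kdelta_def)

lemma kdelta_jidx [simp]:
  "kdelta (Temporal \<alpha>) (Temporal \<beta>) = kdelta \<alpha> \<beta>"
  "kdelta (Spatial i) (Spatial j) = kdelta i j"
  "kdelta (Vertical i \<alpha>) (Vertical j \<beta>) = kdelta i j * kdelta \<alpha> \<beta>"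
  "kdelta (Temporal \<alpha>) (Spatial i) = 0" "kdelta (Temporal \<alpha>) (Vertical i \<beta>) = 0"
  "kdelta (Spatial i) (Temporal \<alpha>) = 0" "kdelta (Spatial i) (Vertical j \<beta>) = 0"
  "kdelta (Vertical i \<alpha>) (Temporal \<beta>) = 0" "kdelta (Vertical i \<alpha>) (Spatial j) = 0"
  by (simp_all add: kdelta_def)

text \<open>The \<open>M\<close> and \<open>N\<close> terms of a vertical coframe form cancel the
  fibre components of the temporal and spatial adapted vectors.\<close>

lemma coframe_frame: "coframe h g U D z (frame h g U A z) = kdelta D A"
  by (cases D; cases A) (simp_all add: axis_nth_kdelta)

lemma coframe_sum_frame:
  "coframe h g U D z (\<Sum>E\<in>UNIV. c E *\<^sub>R frame h g U E z) = c D"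
  by (simp add: linear_sum[OF linear_coframe] linear_cmul[OF linear_coframe] coframe_frame)

text \<open>The \<open>t\<close>- and \<open>x\<close>-components of adapted fields are constant, so
  only fibre components of the bracket can survive.\<close>

lemma coframe_lie_bracket_frame:
  "coframe h g U (Temporal \<alpha>) z (lie_bracket (frame h g U C) (frame h g U B) z) = 0"
  "coframe h g U (Spatial i) z (lie_bracket (frame h g U C) (frame h g U B) z) = 0"
proof -
  have 1: "vf_apply X (\<lambda>u. frame h g U A u \<bullet> (b, 0)) z = 0" for A b X
    by (cases A) simp_all
  have 2: "vf_apply X (\<lambda>u. frame h g U A u \<bullet> (0, b, 0)) z = 0" for A b X
    by (cases A) simp_all
  have "fst (lie_bracket (frame h g U C) (frame h g U B) z) = 0"
    "fst (snd (lie_bracket (frame h g U C) (frame h g U B) z)) = 0"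
    unfolding lie_bracket_def
    by (simp_all add: sum_Basis_prod 1 2 fst_sum snd_sum)
  then show "coframe h g U (Temporal \<alpha>) z (lie_bracket (frame h g U C) (frame h g U B) z) = 0"
    "coframe h g U (Spatial i) z (lie_bracket (frame h g U C) (frame h g U B) z) = 0"
    by (cases "lie_bracket (frame h g U C) (frame h g U B) z"; simp)+
qed

text \<open>A frame field has constant adapted components, so only the connection coefficients
  remain. The direction \<open>X\<close> stays arbitrary because a Lie bracket is inserted
  later.\<close>

lemma nabla_frame:
  "nabla h g U X (frame h g U A) z =
     (\<Sum>D\<in>UNIV. (\<Sum>B\<in>UNIV. cartan_coeff h g D A B z * coframe h g U B z (X z)) *\<^sub>R frame h g U D z)"
proof -
  have "(\<Sum>A'\<in>UNIV. \<Sum>B\<in>UNIV. cartan_coeff h g D A' B z * kdelta A' A * coframe h g U B z (X z)) =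
      (\<Sum>B\<in>UNIV. cartan_coeff h g D A B z * coframe h g U B z (X z))" for D
    by (subst sum.swap) (simp flip: sum_distrib_right)
  then show ?thesis
    unfolding nabla_def by (simp add: coframe_frame)
qed

lemma nabla_frame_frame:
  "nabla h g U (frame h g U B) (frame h g U A) z =
     (\<Sum>D\<in>UNIV. cartan_coeff h g D A B z *\<^sub>R frame h g U D z)"
  by (simp add: nabla_frame coframe_frame)

lemma cartan_coeff_Vertical [simp]: "cartan_coeff h g D A (Vertical i \<alpha>) z = 0"
  by (cases z; cases D; cases A) simp_all

lemma nabla_lie_bracket_frame:
  "nabla h g U (lie_bracket (frame h g U C) (frame h g U B)) (frame h g U A) z = 0"
  by (simp add: nabla_frame sum_jidx coframe_lie_bracket_frame)

text \<open>With the bracket term gone this is the classical coordinate formula, with adapted fields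
  in place of coordinate derivatives.\<close>

lemma curv_comp_eq:
  "curv_comp h g U D A B C z =
     vf_apply (frame h g U C) (cartan_coeff h g D A B) z
     - vf_apply (frame h g U B) (cartan_coeff h g D A C) z
     + (\<Sum>E\<in>UNIV. cartan_coeff h g E A B z * cartan_coeff h g D E C z)
     - (\<Sum>E\<in>UNIV. cartan_coeff h g E A C z * cartan_coeff h g D E B z)"
proof -
  have *: "coframe h g U D z (nabla h g U (frame h g U C) (nabla h g U (frame h g U B) (frame h g U A)) z)
    = vf_apply (frame h g U C) (cartan_coeff h g D A B) z
      + (\<Sum>E\<in>UNIV. cartan_coeff h g E A B z * cartan_coeff h g D E C z)" for B C
    unfolding nabla_def[of h g U "frame h g U C"]
    by (simp add: coframe_sum_frame nabla_frame_frame coframe_frame mult.commute)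
  show ?thesis
    unfolding curv_comp_def curvature_def
    by (simp add: linear_diff[OF linear_coframe] * nabla_lie_bracket_frame linear_0[OF linear_coframe])
qed

lemma vf_apply_cartan_coeff:
  "vf_apply (frame h g U (Temporal \<gamma>)) (cartan_coeff h g D A B) (t, x, y) =
     partial_deriv (axis \<gamma> 1) (\<lambda>t. cartan_coeff h g D A B (t, x, y)) t"
  "vf_apply (frame h g U (Spatial i)) (cartan_coeff h g D A B) (t, x, y) =
     partial_deriv (axis i 1) (\<lambda>x. cartan_coeff h g D A B (t, x, y)) x"
  "vf_apply (frame h g U (Vertical j \<beta>)) (cartan_coeff h g D A B) (t, x, y) = 0"
proof -
  have "cartan_coeff h g D A B (t, x, y') = cartan_coeff h g D A B (t, x, y)" for t x y'
    by (cases D; cases A; cases B) simp_all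
  from vf_apply_frame[of "cartan_coeff h g D A B", OF this]
  show "vf_apply (frame h g U (Temporal \<gamma>)) (cartan_coeff h g D A B) (t, x, y) =
     partial_deriv (axis \<gamma> 1) (\<lambda>t. cartan_coeff h g D A B (t, x, y)) t"
  "vf_apply (frame h g U (Spatial i)) (cartan_coeff h g D A B) (t, x, y) =
     partial_deriv (axis i 1) (\<lambda>x. cartan_coeff h g D A B (t, x, y)) x"
  "vf_apply (frame h g U (Vertical j \<beta>)) (cartan_coeff h g D A B) (t, x, y) = 0" .
qed

section \<open>Block form of the Ricci tensor and of the potential\<close>

fun ricci_block ::
  "(real^'p \<Rightarrow> real^'p^'p) \<Rightarrow> (real^'n \<Rightarrow> real^'n^'n) \<Rightarrow> ('p, 'n) jidx \<Rightarrow> ('p, 'n) jidx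
   \<Rightarrow> real^'p \<Rightarrow> real^'n \<Rightarrow> real" where
  "ricci_block h g (Temporal \<alpha>) (Temporal \<beta>) t x = ricci h \<alpha> \<beta> t"
| "ricci_block h g (Spatial i) (Spatial j) t x = ricci g i j x"
| "ricci_block h g _ _ t x = 0"

text \<open>A vertical \<open>D\<close> in the trace, or a vertical \<open>B\<close>, is a
  differentiating index and contributes nothing. The connection takes no vertical field to a
  temporal or spatial one, which settles vertical \<open>A\<close>; mixed entries vanish because
  \<open>h\<close> depends on \<open>t\<close> alone and \<open>g\<close> on \<open>x\<close>
  alone.\<close>

lemma Ric_eq: "Ric h g U A B (t, x, y) = ricci_block h g A B t x"
  by (cases A; cases B)
    (simp_all add: Ric_def curv_comp_eq sum_jidx vf_apply_cartan_coeff ricci_def riemann_def)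

text \<open>The third matrix is a separate argument so that one shape covers the potential, built
  from \<open>h\<close>, \<open>g\<close> and the inverse of \<open>h\<close>, and its inverse,
  where all three are inverted.\<close>

fun metric_block ::
  "real^'p^'p \<Rightarrow> real^'n^'n \<Rightarrow> real^'p^'p \<Rightarrow> ('p, 'n) jidx \<Rightarrow> ('p, 'n) jidx \<Rightarrow> real" where
  "metric_block h g k (Temporal \<alpha>) (Temporal \<beta>) = h $ \<alpha> $ \<beta>"
| "metric_block h g k (Spatial i) (Spatial j) = g $ i $ j"
| "metric_block h g k (Vertical i \<alpha>) (Vertical j \<beta>) = k $ \<alpha> $ \<beta> * g $ i $ j"
| "metric_block h g k _ _ = 0"

lemma G_comp_eq: "G_comp h g U A B (t, x, y) = metric_block (h t) (g x) (matrix_inv (h t)) A B"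
proof -
  have "G_comp h g U A B (t, x, y) =
     (\<Sum>\<alpha>\<in>UNIV. \<Sum>\<beta>\<in>UNIV. h t $ \<alpha> $ \<beta> * kdelta (Temporal \<alpha>) A * kdelta (Temporal \<beta>) B)
     + (\<Sum>i\<in>UNIV. \<Sum>j\<in>UNIV. g x $ i $ j * kdelta (Spatial i) A * kdelta (Spatial j) B)
     + (\<Sum>\<alpha>\<in>UNIV. \<Sum>\<beta>\<in>UNIV. \<Sum>i\<in>UNIV. \<Sum>j\<in>UNIV. matrix_inv (h t) $ \<alpha> $ \<beta> * g x $ i $ j *
        kdelta (Vertical i \<alpha>) A * kdelta (Vertical j \<beta>) B)"
    unfolding G_comp_def G_potential_def by (simp only: coframe_frame prod.case)
  then show ?thesis
    by (cases A; cases B) (simp_all flip: mult.assoc sum_distrib_right)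
qed

section \<open>Divergence of the Einstein tensor\<close>

lemma matrix_inv_sum:
  fixes A :: "real^'n^'n"
  assumes "det A \<noteq> 0"
  shows "(\<Sum>k\<in>UNIV. matrix_inv A $ i $ k * A $ k $ j) = kdelta i j"
    and "(\<Sum>k\<in>UNIV. A $ i $ k * matrix_inv A $ k $ j) = kdelta i j"
  using arg_cong[OF matrix_inv_mult(1)[OF assms], of "\<lambda>B. B $ i $ j"]
    arg_cong[OF matrix_inv_mult(2)[OF assms], of "\<lambda>B. B $ i $ j"]
  by (simp_all add: matrix_matrix_mult_def mat_def kdelta_def)

lemma metric_block_inverse:
  assumes "det h \<noteq> 0" "det g \<noteq> 0"
  shows "(\<Sum>D\<in>UNIV. metric_block (matrix_inv h) (matrix_inv g) h B D *
           metric_block h g (matrix_inv h) D A) = kdelta B A"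
proof -
  \<comment> \<open>The vertical block is a tensor product of two matrices, so its double sum
    factors into two contractions, each a Kronecker delta.\<close>
  have "(\<Sum>k\<in>UNIV. \<Sum>\<gamma>\<in>UNIV. (h $ \<alpha> $ \<gamma> * matrix_inv g $ i $ k) * (matrix_inv h $ \<gamma> $ \<beta> * g $ k $ j))
      = (\<Sum>k\<in>UNIV. matrix_inv g $ i $ k * g $ k $ j) * (\<Sum>\<gamma>\<in>UNIV. h $ \<alpha> $ \<gamma> * matrix_inv h $ \<gamma> $ \<beta>)"
    for \<alpha> \<beta> i j
    unfolding sum_product by (simp add: mult_ac)
  then show ?thesis
    using assms by (cases B; cases A) (simp_all add: sum_jidx matrix_inv_sum)
qed

lemma G_inv_eq:
  assumes "det (h t) \<noteq> 0" "det (g x) \<noteq> 0"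
  shows "G_inv h g U A B (t, x, y) = metric_block (matrix_inv (h t)) (matrix_inv (g x)) (h t) A B"
proof -
  have "(\<chi> A B. metric_block (matrix_inv (h t)) (matrix_inv (g x)) (h t) A B) **
      (\<chi> A B. G_comp h g U A B (t, x, y)) = mat 1"
    using metric_block_inverse[OF assms]
    by (simp add: vec_eq_iff matrix_matrix_mult_def mat_def G_comp_eq kdelta_def)
  from matrix_inv_unique[OF this] show ?thesis
    by (simp add: G_inv_def)
qed

text \<open>The vertical Ricci block is zero, so the vertical block of the inverse potential adds
  nothing to the trace.\<close>

lemma Sc_eq:
  assumes "det (h t) \<noteq> 0" "det (g x) \<noteq> 0"
  shows "Sc h g U (t, x, y) = scalar_curv h t + scalar_curv g x"
  using assms by (simp add: Sc_def sum_jidx G_inv_eq Ric_eq scalar_curv_def)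

text \<open>These are the mixed components of \<open>Ric - Sc/2 G\<close>; in the vertical block
  only the trace term is left.\<close>

fun einstein_block ::
  "(real^'p \<Rightarrow> real^'p^'p) \<Rightarrow> (real^'n \<Rightarrow> real^'n^'n) \<Rightarrow> ('p, 'n) jidx \<Rightarrow> ('p, 'n) jidx
   \<Rightarrow> real^'p \<Rightarrow> real^'n \<Rightarrow> real" where
  "einstein_block h g (Temporal \<mu>) (Temporal \<beta>) t x =
     ricci_mixed h \<mu> \<beta> t - (scalar_curv h t + scalar_curv g x) / 2 * kdelta \<mu> \<beta>"
| "einstein_block h g (Spatial m) (Spatial j) t x =
     ricci_mixed g m j x - (scalar_curv h t + scalar_curv g x) / 2 * kdelta m j"
| "einstein_block h g (Vertical i \<alpha>) (Vertical j \<beta>) t x =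
     - ((scalar_curv h t + scalar_curv g x) / 2 * (kdelta i j * kdelta \<alpha> \<beta>))"
| "einstein_block h g _ _ t x = 0"

text \<open>Raising an index in the Einstein equations turns the potential into the Kronecker
  delta.\<close>

lemma mixed_einstein:
  assumes "det (h t) \<noteq> 0" "det (g x) \<noteq> 0" "einstein_at h g U \<K> \<T> (t, x, y)"
  shows "\<K> * mixed h g U \<T> B A (t, x, y) = einstein_block h g B A t x"
proof -
  let ?H = "metric_block (matrix_inv (h t)) (matrix_inv (g x)) (h t)"
  let ?G = "metric_block (h t) (g x) (matrix_inv (h t))"
  let ?s = "scalar_curv h t + scalar_curv g x"
  have "\<K> * mixed h g U \<T> B A (t, x, y) =
      (\<Sum>D\<in>UNIV. ?H B D * (ricci_block h g D A t x - ?s / 2 * ?G D A))"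
    using assms
    by (simp add: mixed_def G_inv_eq einstein_at_def Ric_eq Sc_eq G_comp_eq sum_distrib_left
        mult.left_commute)
  also have "\<dots> = (\<Sum>D\<in>UNIV. ?H B D * ricci_block h g D A t x)
      - ?s / 2 * (\<Sum>D\<in>UNIV. ?H B D * ?G D A)"
    by (simp add: right_diff_distrib sum_subtractf sum_distrib_left mult.left_commute)
  also have "\<dots> = (\<Sum>D\<in>UNIV. ?H B D * ricci_block h g D A t x) - ?s / 2 * kdelta B A"
    by (simp only: metric_block_inverse[OF assms(1,2)])
  also have "\<dots> = einstein_block h g B A t x"
    by (cases B; cases A) (simp_all add: sum_jidx ricci_mixed_def)
  finally show ?thesis .
qed

text \<open>Smoothness separately in \<open>t\<close> and in \<open>x\<close> suffices, since an
  adapted field differentiates functions of \<open>(t, x)\<close> in at most one of the two.\<close>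

lemma smooth_on_einstein_block:
  assumes "open P" "\<And>i j. smooth_on P (\<lambda>t. h t $ i $ j)" "\<And>t. t \<in> P \<Longrightarrow> det (h t) \<noteq> 0"
    and "open Q" "\<And>i j. smooth_on Q (\<lambda>x. g x $ i $ j)" "\<And>x. x \<in> Q \<Longrightarrow> det (g x) \<noteq> 0"
  shows "smooth_on P (\<lambda>t. einstein_block h g B A t x)"
    and "smooth_on Q (\<lambda>x. einstein_block h g B A t x)"
proof -
  note P = smooth_on_ricci_mixed[OF assms(1-3)] smooth_on_scalar_curv[OF assms(1-3)]
  note Q = smooth_on_ricci_mixed[OF assms(4-6)] smooth_on_scalar_curv[OF assms(4-6)]
  have H: "smooth_on P (\<lambda>t. (scalar_curv h t + r) / 2 * c)" for r c
    by (intro smooth_on_mult smooth_on_divide smooth_on_add smooth_on_const assms P) auto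
  have R: "smooth_on Q (\<lambda>x. (r + scalar_curv g x) / 2 * c)" for r c
    by (intro smooth_on_mult smooth_on_divide smooth_on_add smooth_on_const assms Q) auto
  show "smooth_on P (\<lambda>t. einstein_block h g B A t x)"
    \<comment> \<open>The vertical entry carries a unary minus and is treated as a difference from
      zero.\<close>
    using P H smooth_on_diff[OF assms(1) smooth_on_const[of P 0] H]
    by (cases B; cases A) (auto intro: smooth_on_const smooth_on_diff assms)
  show "smooth_on Q (\<lambda>x. einstein_block h g B A t x)"
    using Q R smooth_on_diff[OF assms(4) smooth_on_const[of Q 0] R]
    by (cases B; cases A) (auto intro: smooth_on_const smooth_on_diff assms)
qed

text \<open>The regularity of the mixed tensor comes from the metrics, through the Einstein
  equations.\<close>

lemma cov_deriv_mixed_einstein: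
  fixes U :: "(real^'p) \<times> (real^'n) \<Rightarrow> real^'p^'n"
  assumes P: "open P" "\<And>i j. smooth_on P (\<lambda>t. h t $ i $ j)" "\<And>t. t \<in> P \<Longrightarrow> det (h t) \<noteq> 0"
    and Q: "open Q" "\<And>i j. smooth_on Q (\<lambda>x. g x $ i $ j)" "\<And>x. x \<in> Q \<Longrightarrow> det (g x) \<noteq> 0"
    and E: "\<And>t x y. t \<in> P \<Longrightarrow> x \<in> Q \<Longrightarrow> einstein_at h g U \<K> \<T> (t, x, y)"
    and K: "\<K> \<noteq> 0" and tx: "t \<in> P" "x \<in> Q"
  shows "cov_deriv h g U (mixed h g U \<T>) B A C (t, x, y) =
    cov_deriv h g U (\<lambda>B A (t, x, y). einstein_block h g B A t x) B A C (t, x, y) / \<K>"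
proof -
  have eq: "mixed h g U \<T> B A (t, x, y) = einstein_block h g B A t x / \<K>"
    if "t \<in> P" "x \<in> Q" for t x y B A
    using mixed_einstein[OF P(3)[OF that(1)] Q(3)[OF that(2)] E[OF that], of B A y] K
    by (simp add: field_simps)
  note sm = smooth_on_einstein_block[OF P Q]
  \<comment> \<open>A derivative at a point sees a neighbourhood, so the Einstein equations are used
    on an open set.\<close>
  have "open (P \<times> Q \<times> (UNIV :: (real^'p^'n) set))"
    using P(1) Q(1) by (intro open_Times) auto
  then have "vf_apply (frame h g U C) (mixed h g U \<T> B A) (t, x, y) =
      vf_apply (frame h g U C) (\<lambda>(t, x, y). einstein_block h g B A t x / \<K>) (t, x, y)"
    by (rule vf_apply_cong) (use tx eq in auto)
  also have "\<dots> = vf_apply (frame h g U C) (\<lambda>(t, x, y). einstein_block h g B A t x) (t, x, y) / \<K>"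
  proof -
    note 1 = vf_apply_frame[where f = "\<lambda>(t, x, y). einstein_block h g B A t x / \<K>"
        and F = "\<lambda>t x. einstein_block h g B A t x / \<K>"]
    note 2 = vf_apply_frame[where f = "\<lambda>(t, x, y). einstein_block h g B A t x"
        and F = "\<lambda>t x. einstein_block h g B A t x"]
    show ?thesis
      using partial_deriv_divide[OF sm(1) tx(1)] partial_deriv_divide[OF sm(2) tx(2)]
      by (cases C) (simp_all add: 1 2)
  qed
  finally show ?thesis
    unfolding cov_deriv_def
    by (simp add: eq[OF tx] sum_divide_distrib add_divide_distrib diff_divide_distrib)
qed

text \<open>Tensor and connection respect the three families, so each divergence stays within its
  own. Vertical differentiation has zero coefficients, and the vertical block does not vary along
  the fibres.\<close>

lemma divergence_einstein_block:
  fixes h :: "real^'p \<Rightarrow> real^'p^'p" and g :: "real^'n \<Rightarrow> real^'n^'n"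
    and U :: "(real^'p) \<times> (real^'n) \<Rightarrow> real^'p^'n"
  defines "dvg \<equiv> \<lambda>A z. \<Sum>B\<in>UNIV.
    cov_deriv h g U (\<lambda>B A (t, x, y). einstein_block h g B A t x) B A B z"
  shows "dvg (Temporal \<beta>) z = (\<Sum>\<mu>\<in>UNIV. t_cov_deriv h g U (\<lambda>\<mu> \<beta> (t, x, y).
        ricci_mixed h \<mu> \<beta> t - (scalar_curv h t + scalar_curv g x) / 2 * kdelta \<mu> \<beta>) \<mu> \<beta> \<mu> z)"
    and "dvg (Spatial j) z = (\<Sum>m\<in>UNIV. x_cov_deriv h g U (\<lambda>m j (t, x, y).
        ricci_mixed g m j x - (scalar_curv h t + scalar_curv g x) / 2 * kdelta m j) m j m z)"
    and "dvg (Vertical i \<alpha>) z = 0"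
proof -
  \<comment> \<open>Off-diagonal blocks unfold to a tuple abstraction over zero, not literally a
    constant function.\<close>
  have 0: "vf_apply X (\<lambda>(t, x, y). 0) z = 0" for X :: "('p, 'n) jcoord \<Rightarrow> ('p, 'n) jcoord" and z
    by (simp add: split_def)
  obtain t x y where z: "z = (t, x, y)" by (cases z)
  have V: "vf_apply (frame h g U (Vertical i \<alpha>)) (\<lambda>(t, x, y). F t x) z = 0" for i \<alpha> F
    unfolding z by (rule vf_apply_frame) simp
  show "dvg (Temporal \<beta>) z = (\<Sum>\<mu>\<in>UNIV. t_cov_deriv h g U (\<lambda>\<mu> \<beta> (t, x, y).
        ricci_mixed h \<mu> \<beta> t - (scalar_curv h t + scalar_curv g x) / 2 * kdelta \<mu> \<beta>) \<mu> \<beta> \<mu> z)"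
    unfolding dvg_def cov_deriv_def t_cov_deriv_def z by (simp add: sum_jidx 0)
  show "dvg (Spatial j) z = (\<Sum>m\<in>UNIV. x_cov_deriv h g U (\<lambda>m j (t, x, y).
        ricci_mixed g m j x - (scalar_curv h t + scalar_curv g x) / 2 * kdelta m j) m j m z)"
    unfolding dvg_def cov_deriv_def x_cov_deriv_def z by (simp add: sum_jidx 0)
  show "dvg (Vertical i \<alpha>) z = 0"
    unfolding dvg_def cov_deriv_def by (simp add: sum_jidx 0 V)
qed

section \<open>Metrics in charts and the equivalence on the jet bundle\<close>

lemma det_comps_nonzero:
  fixes B :: "real^'n \<Rightarrow> real^'n \<Rightarrow> real"
  assumes B: "bilinear B" and nd: "\<And>v. (\<forall>w. B v w = 0) \<Longrightarrow> v = 0"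
  shows "det (comps B) \<noteq> 0"
proof -
  \<comment> \<open>Entry \<open>j\<close> of the product is \<open>B v (axis j 1)\<close>; the
    transpose appears because nondegeneracy is stated in the first slot. A kernel vector pairs to
    zero with a basis, hence with every \<open>w\<close>.\<close>
  have "v = 0" if v: "transpose (comps B) *v v = 0" for v
  proof (rule nd, rule allI)
    fix w
    have "B v (axis j 1) = 0" for j
    proof -
      have L: "linear (\<lambda>v. B v (axis j 1))" using B by (simp add: bilinear_def)
      have "B (\<Sum>i\<in>UNIV. v $ i *\<^sub>R axis i 1) (axis j 1) = (\<Sum>i\<in>UNIV. v $ i * B (axis i 1) (axis j 1))"
        using linear_sum[OF L, of "\<lambda>i. v $ i *\<^sub>R axis i 1"] linear_cmul[OF L] by simp
      also have "\<dots> = (transpose (comps B) *v v) $ j"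
        by (simp add: matrix_vector_mult_def transpose_def comps_def mult.commute)
      finally show ?thesis
        using v by (simp add: basis_expansion flip: scalar_mult_eq_scaleR)
    qed
    moreover have "B v (\<Sum>j\<in>UNIV. w $ j *\<^sub>R axis j 1) = (\<Sum>j\<in>UNIV. w $ j * B v (axis j 1))"
    proof -
      have "linear (B v)" using B by (simp add: bilinear_def)
      then show ?thesis by (simp add: linear_sum[of "B v"] linear_cmul[of "B v"])
    qed
    ultimately show "B v w = 0"
      by (simp add: basis_expansion flip: scalar_mult_eq_scaleR)
  qed
  then have "det (transpose (comps B)) \<noteq> 0"
    by (metis matrix_left_invertible_ker invertible_left_inverse invertible_det_nz)
  then show ?thesis by simp
qed

lemma semi_riemannian_comps:
  fixes \<A> :: "('a, real^'n) chart set"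
  assumes "semi_riemannian \<A> g" "c \<in> \<A>"
  shows "smooth_on (chart_image c) (\<lambda>u. comps (g c u) $ i $ j)"
    and "u \<in> chart_image c \<Longrightarrow> det (comps (g c u)) \<noteq> 0"
proof -
  show "smooth_on (chart_image c) (\<lambda>u. comps (g c u) $ i $ j)"
    using assms by (simp add: semi_riemannian_def tensor02_def comps_def)
  show "det (comps (g c u)) \<noteq> 0" if "u \<in> chart_image c"
    using assms that by (intro det_comps_nonzero) (auto simp: semi_riemannian_def tensor02_def)
qed

lemma conservation_iff_reduced:
  fixes U :: "(real^'p) \<times> (real^'n) \<Rightarrow> real^'p^'n"
  assumes "open P" "\<And>i j. smooth_on P (\<lambda>t. h t $ i $ j)" "\<And>t. t \<in> P \<Longrightarrow> det (h t) \<noteq> 0"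
    and "open Q" "\<And>i j. smooth_on Q (\<lambda>x. g x $ i $ j)" "\<And>x. x \<in> Q \<Longrightarrow> det (g x) \<noteq> 0"
    and "\<And>t x y. t \<in> P \<Longrightarrow> x \<in> Q \<Longrightarrow> einstein_at h g U \<K> \<T> (t, x, y)"
    and K: "\<K> \<noteq> 0" and "t \<in> P" "x \<in> Q"
  shows "conservation_at h g U \<T> (t, x, y) \<longleftrightarrow> reduced_at h g U (t, x, y)"
proof -
  have all: "(\<forall>A :: ('p, 'n) jidx. Z A) \<longleftrightarrow>
      (\<forall>\<beta>. Z (Temporal \<beta>)) \<and> (\<forall>j. Z (Spatial j)) \<and> (\<forall>i \<alpha>. Z (Vertical i \<alpha>))" for Z
    by (metis jidx.exhaust)
  have "(\<Sum>B\<in>UNIV. cov_deriv h g U (mixed h g U \<T>) B A B (t, x, y)) =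
      (\<Sum>B\<in>UNIV. cov_deriv h g U (\<lambda>B A (t, x, y). einstein_block h g B A t x) B A B (t, x, y)) / \<K>"
    for A
    unfolding sum_divide_distrib by (intro sum.cong refl cov_deriv_mixed_einstein[OF assms])
  then have "conservation_at h g U \<T> (t, x, y) \<longleftrightarrow> (\<forall>A. (\<Sum>B\<in>UNIV.
      cov_deriv h g U (\<lambda>B A (t, x, y). einstein_block h g B A t x) B A B (t, x, y)) = 0)"
    using K by (simp add: conservation_at_def)
  \<comment> \<open>The vertical equations have become trivial; the temporal and spatial ones are
    literally the two reduced ones.\<close>
  then show ?thesis
    by (simp only: reduced_at_def all divergence_einstein_block simp_thms)
qed

theorem theorem4p2:
  fixes T :: "'a topology" and \<A> :: "('a, real^'p) chart set"
    and M :: "'b topology" and \<B> :: "('b, real^'n) chart set"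
    and h :: "('a, real^'p) tensor_field2" and g :: "('b, real^'n) tensor_field2"
    and U :: "('a, real^'p) chart \<Rightarrow> ('b, real^'n) chart \<Rightarrow> (real^'p) \<times> (real^'n) \<Rightarrow> real^'p^'n"
    and F :: "'a \<times> 'b \<Rightarrow> real" and L :: "('a, 'b, 'p, 'n) jet \<Rightarrow> real"
    and \<T> :: "(('a, 'b, 'p, 'n) jet, ('p, 'n) jcoord) tensor_field2" and \<K> :: real
  assumes "EDML T \<A> M \<B> h g U F L"
    and "\<K> \<noteq> 0"
    and "tensor02 (jet_atlas T \<A> M \<B>) \<T>"
    and "\<forall>c\<in>\<A>. \<forall>d\<in>\<B>. \<forall>z\<in>chart_image (jet_chart T \<A> M \<B> c d).
           einstein_at (\<lambda>t. comps (h c t)) (\<lambda>x. comps (g d x)) (U c d)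
             \<K> (\<T> (jet_chart T \<A> M \<B> c d)) z"
  shows "(\<forall>c\<in>\<A>. \<forall>d\<in>\<B>. \<forall>z\<in>chart_image (jet_chart T \<A> M \<B> c d).
            conservation_at (\<lambda>t. comps (h c t)) (\<lambda>x. comps (g d x)) (U c d)
              (\<T> (jet_chart T \<A> M \<B> c d)) z)
     \<longleftrightarrow> (\<forall>c\<in>\<A>. \<forall>d\<in>\<B>. \<forall>z\<in>chart_image (jet_chart T \<A> M \<B> c d).
            reduced_at (\<lambda>t. comps (h c t)) (\<lambda>x. comps (g d x)) (U c d) z)"
proof (intro ball_cong refl)
  \<comment> \<open>Both sides range over the same charts and points, so they are compared at one
    point of one induced chart.\<close>
  fix c d z
  assume c: "c \<in> \<A>" and d: "d \<in> \<B>" and z: "z \<in> chart_image (jet_chart T \<A> M \<B> c d)"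
  have T: "smooth_atlas T \<A>" and M: "smooth_atlas M \<B>"
    and h: "semi_riemannian \<A> h" and g: "semi_riemannian \<B> g"
    using assms(1) by (auto simp: EDML_def smooth_manifold_def)
  \<comment> \<open>An induced chart fills the whole fibre, so the Einstein equations hold on a full
    product, as the local equivalence requires.\<close>
  have im: "chart_image (jet_chart T \<A> M \<B> c d) = chart_image c \<times> chart_image d \<times> UNIV"
    by (rule jet_chart_image[OF T M c d])
  obtain t x y where txy: "z = (t, x, y)" "t \<in> chart_image c" "x \<in> chart_image d"
    using z unfolding im by auto
  have o: "open (chart_image c)" "open (chart_image d)"
    using T M c d by (auto simp: smooth_atlas_def)
  show "conservation_at (\<lambda>t. comps (h c t)) (\<lambda>x. comps (g d x)) (U c d)
      (\<T> (jet_chart T \<A> M \<B> c d)) z \<longleftrightarrow>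
    reduced_at (\<lambda>t. comps (h c t)) (\<lambda>x. comps (g d x)) (U c d) z"
    unfolding txy(1)
  proof (rule conservation_iff_reduced[OF o(1) _ _ o(2) _ _ _ assms(2) txy(2,3)])
    show "einstein_at (\<lambda>t. comps (h c t)) (\<lambda>x. comps (g d x)) (U c d) \<K>
        (\<T> (jet_chart T \<A> M \<B> c d)) (t, x, y)"
      if "t \<in> chart_image c" "x \<in> chart_image d" for t x y
      using assms(4) c d that im by blast
  qed (use semi_riemannian_comps[OF h c] semi_riemannian_comps[OF g d] in auto)
qed

end
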